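(* For any positive integer $s$, the graph $S(\lceil s/2\rceil,s)$ is matching unique except when $s\in\{3,4,5\}$, in which cases it is not matching unique. In particular, for any positive integer $n\ne 2$, the friendship graph $F_n$ is matching unique.
   Context: All graphs are finite, simple and undirected. For a graph $G$ of order $n$ (number of vertices), $m(G,k)$ is the number of $k$-matchings (sets of $k$ pairwise nonincident edges), $m(G,0)=1$, and the matching polynomial of $G$ is $\mu(G,x)=\sum_{k\ge 0}(-1)^k m(G,k)x^{n-2k}$. Two nonisomorphic graphs with the same matching polynomial are comatching. A graph $G$ is matching unique if it has no comatching graph, i.e. every graph $H$ (connected or not) with $\mu(H,x)=\mu(G,x)$ is isomorphic to $G$. For integers $r\ge 1$ and $r\le s\le 2r$, $S(r,s)$ is the graph obtained from $r$ disjoint copies of $K_2$ by adding a new vertex $u$ and joining $u$ to them by $s$ edges so that the result is connected; i.e. $u$ is joined to both ends of $s-r$ of the copies of $K_2$ and to exactly one end of each of the other $2r-s$ copies. The friendship graph $F_n$ is the graph consisting of $n$ triangles intersecting in a single common vertex; thus $F_n\simeq S(n,2n)$. *)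

theory Defs
  imports Complex_Main "HOL-Computational_Algebra.Polynomial"
begin

type_synonym 'a ugraph = "'a set \<times> 'a set set"

abbreviation verts :: "'a ugraph \<Rightarrow> 'a set" where "verts \<equiv> fst"
abbreviation edges :: "'a ugraph \<Rightarrow> 'a set set" where "edges \<equiv> snd"

definition simple_graph :: "'a ugraph \<Rightarrow> bool" where
  "simple_graph G \<longleftrightarrow> finite (verts G) \<and> (\<forall>e\<in>edges G. e \<subseteq> verts G \<and> card e = 2)"

definition graph_iso :: "'a ugraph \<Rightarrow> 'b ugraph \<Rightarrow> bool" where
  "graph_iso G H \<longleftrightarrow> (\<exists>f. bij_betw f (verts G) (verts H) \<and>
     (\<forall>u\<in>verts G. \<forall>v\<in>verts G. {u, v} \<in> edges G \<longleftrightarrow> {f u, f v} \<in> edges H))"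

definition matchings :: "'a ugraph \<Rightarrow> nat \<Rightarrow> 'a set set set" where
  "matchings G k = {M. M \<subseteq> edges G \<and> card M = k \<and> (\<forall>e\<in>M. \<forall>f\<in>M. e \<noteq> f \<longrightarrow> e \<inter> f = {})}"

definition num_matchings :: "'a ugraph \<Rightarrow> nat \<Rightarrow> nat" where
  "num_matchings G k = card (matchings G k)"

text \<open>A \<open>k\<close>-matching covers \<open>2 * k\<close> vertices, so the sum over all \<open>k\<close> may be cut off at
  half the order; this keeps the truncated subtraction in the exponent exact.\<close>

definition matching_poly :: "'a ugraph \<Rightarrow> int poly" where
  "matching_poly G = (\<Sum>k\<le>card (verts G) div 2.
     monom ((-1) ^ k * int (num_matchings G k)) (card (verts G) - 2 * k))"

definition comatching :: "'a ugraph \<Rightarrow> 'b ugraph \<Rightarrow> bool" where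
  "comatching G H \<longleftrightarrow> \<not> graph_iso G H \<and> matching_poly G = matching_poly H"

text \<open>A definition cannot quantify over all vertex types, so \<open>H\<close> ranges over the graphs on
  natural numbers. Every finite graph is isomorphic to one of these; the lemma
  \<open>matching_uniqueD\<close> below gives the property for graphs over any type.\<close>

definition matching_unique :: "'a ugraph \<Rightarrow> bool" where
  "matching_unique G \<longleftrightarrow> \<not> (\<exists>H :: nat ugraph. simple_graph H \<and> comatching G H)"

text \<open>The vertex \<open>u\<close> is \<open>0\<close> and the \<open>i\<close>-th copy of \<open>K\<^sub>2\<close> has ends \<open>2 * i + 1\<close> and \<open>2 * i + 2\<close>.
  The first end is always joined to \<open>u\<close>, the second one only in the first \<open>s - r\<close> copies.
  Meaningful for \<open>1 \<le> r \<le> s \<le> 2 * r\<close>.\<close>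

definition S_graph :: "nat \<Rightarrow> nat \<Rightarrow> nat ugraph" where
  "S_graph r s = ({0..2 * r},
     {{2 * i + 1, 2 * i + 2} | i. i < r} \<union> {{0, 2 * i + 1} | i. i < r} \<union>
     {{0, 2 * i + 2} | i. i < s - r})"

definition friendship_graph :: "nat \<Rightarrow> nat ugraph" where
  "friendship_graph n = ({0..2 * n},
     (\<Union>i<n. {{0, 2 * i + 1}, {0, 2 * i + 2}, {2 * i + 1, 2 * i + 2}}))"

lemma simple_graph_S_graph: "s \<le> 2 * r \<Longrightarrow> simple_graph (S_graph r s)"
  by (auto simp: simple_graph_def S_graph_def)

lemma friendship_graph_eq_S_graph: "friendship_graph n = S_graph n (2 * n)"
  proof -
  have "edges (friendship_graph n) = edges (S_graph n (2 * n))"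
    unfolding friendship_graph_def S_graph_def by (simp add: Setcompr_eq_image) blast
  then show ?thesis
    by (simp add: friendship_graph_def S_graph_def)
qed

lemma num_matchings_0:
  assumes "simple_graph G"
  shows "num_matchings G 0 = 1"
proof -
  have "edges G \<subseteq> Pow (verts G)" and "finite (verts G)"
    using assms by (auto simp: simple_graph_def)
  then have fin: "finite (edges G)"
    by (auto intro: finite_subset[of _ "Pow (verts G)"])
  have "M = {}" if "M \<in> matchings G 0" for M
  proof -
    have "M \<subseteq> edges G" "card M = 0"
      using that by (auto simp: matchings_def)
    then show ?thesis
      using finite_subset[OF _ fin] card_0_eq by blast
  qed
  moreover have "{} \<in> matchings G 0"
    by (simp add: matchings_def)
  ultimately have "matchings G 0 = {{}}"
    by blast
  then show ?thesis
    by (simp add: num_matchings_def)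
qed

lemma graph_iso_sym:
  assumes "graph_iso G H"
  shows "graph_iso H G"
proof -
  obtain f where f: "bij_betw f (verts G) (verts H)"
    and e: "\<And>u v. u \<in> verts G \<Longrightarrow> v \<in> verts G \<Longrightarrow> {u, v} \<in> edges G \<longleftrightarrow> {f u, f v} \<in> edges H"
    using assms unfolding graph_iso_def by blast
  let ?g = "inv_into (verts G) f"
  have "?g u \<in> verts G" "f (?g u) = u" if "u \<in> verts H" for u
    using that f by (metis bij_betw_imp_surj_on inv_into_into, metis bij_betw_inv_into_right)
  then show ?thesis
    unfolding graph_iso_def using bij_betw_inv_into[OF f] e
    by (intro exI[of _ ?g]) auto
qed

lemma graph_iso_trans:
  assumes "graph_iso G H" "graph_iso H K"
  shows "graph_iso G K"
proof -
  obtain f where f: "bij_betw f (verts G) (verts H)"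
    "\<And>u v. u \<in> verts G \<Longrightarrow> v \<in> verts G \<Longrightarrow> {u, v} \<in> edges G \<longleftrightarrow> {f u, f v} \<in> edges H"
    using assms(1) unfolding graph_iso_def by blast
  obtain g where g: "bij_betw g (verts H) (verts K)"
    "\<And>u v. u \<in> verts H \<Longrightarrow> v \<in> verts H \<Longrightarrow> {u, v} \<in> edges H \<longleftrightarrow> {g u, g v} \<in> edges K"
    using assms(2) unfolding graph_iso_def by blast
  have "f u \<in> verts H" if "u \<in> verts G" for u
    using that f(1) by (rule bij_betw_apply[rotated])
  then show ?thesis
    unfolding graph_iso_def using bij_betw_trans[OF f(1) g(1)] f(2) g(2)
    by (intro exI[of _ "g \<circ> f"]) auto
qed

lemma num_matchings_image:
  assumes G: "simple_graph G" and f: "inj_on f (verts G)"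
  shows "num_matchings (f ` verts G, (`) f ` edges G) k = num_matchings G k"
proof -
  have sub: "edges G \<subseteq> Pow (verts G)"
    using G by (auto simp: simple_graph_def)
  have inj1: "inj_on ((`) f) (edges G)"
    using inj_on_subset[OF inj_on_image_Pow[OF f] sub] .
  have inj2: "inj_on ((`) ((`) f)) (matchings G k)"
    by (rule inj_on_subset[OF inj_on_image_Pow[OF inj1]]) (auto simp: matchings_def)
  have disj: "f ` a \<inter> f ` b = {} \<longleftrightarrow> a \<inter> b = {}" if "a \<in> edges G" "b \<in> edges G" for a b
    using that sub inj_on_image_Int[OF f, of a b] by auto
  have eqi: "f ` a = f ` b \<longleftrightarrow> a = b" if "a \<in> edges G" "b \<in> edges G" for a b
    using that inj1 by (auto dest: inj_onD)
  have "matchings (f ` verts G, (`) f ` edges G) k = (`) ((`) f) ` matchings G k" (is "?L = ?R")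
  proof
    show "?L \<subseteq> ?R"
    proof
      fix M assume M: "M \<in> ?L"
      then obtain N where N: "N \<subseteq> edges G" "M = (`) f ` N"
        by (auto simp: matchings_def subset_image_iff)
      have "card N = k"
        using M N card_image[OF inj_on_subset[OF inj1 N(1)]] by (simp add: matchings_def)
      moreover have "a \<inter> b = {}" if ab: "a \<in> N" "b \<in> N" "a \<noteq> b" for a b
      proof -
        have "f ` a \<noteq> f ` b" using eqi[of a b] ab N(1) by blast
        then have "f ` a \<inter> f ` b = {}"
          using M N(2) ab unfolding matchings_def by blast
        then show ?thesis using disj ab N(1) by blast
      qed
      ultimately show "M \<in> ?R"
        using N by (auto simp: matchings_def)
    qed
    show "?R \<subseteq> ?L"
    proof
      fix M assume "M \<in> ?R"
      then obtain N where N: "N \<in> matchings G k" "M = (`) f ` N" by blast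
      then have NE: "N \<subseteq> edges G" by (simp add: matchings_def)
      have "card M = k"
        using N card_image[OF inj_on_subset[OF inj1 NE]] by (simp add: matchings_def)
      moreover have "f ` a \<inter> f ` b = {}" if "a \<in> N" "b \<in> N" "f ` a \<noteq> f ` b" for a b
      proof -
        have "a \<noteq> b" using that(3) by blast
        then have "a \<inter> b = {}" using that(1,2) N(1) unfolding matchings_def by blast
        then show ?thesis using disj that NE by blast
      qed
      ultimately show "M \<in> ?L"
        using N NE by (auto simp: matchings_def)
    qed
  qed
  then show ?thesis
    using card_image[OF inj2] by (simp add: num_matchings_def)
qed

lemma matching_uniqueD:
  fixes G :: "'a ugraph" and H :: "'b ugraph"
  assumes "matching_unique G" "simple_graph H" "matching_poly H = matching_poly G"
  shows "graph_iso H G"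
proof -
  have "finite (verts H)" and sub: "\<And>e. e \<in> edges H \<Longrightarrow> e \<subseteq> verts H"
    using assms(2) by (auto simp: simple_graph_def)
  then obtain f :: "'b \<Rightarrow> nat" where f: "inj_on f (verts H)"
    using finite_imp_inj_to_nat_seg by blast
  define K where "K = (f ` verts H, (`) f ` edges H)"
  have "card (f ` e) = card e" if "e \<in> edges H" for e
    using card_image[OF inj_on_subset[OF f sub[OF that]]] .
  then have K: "simple_graph K"
    using assms(2) by (auto simp: simple_graph_def K_def)
  have "matching_poly K = matching_poly H"
    using num_matchings_image[OF assms(2) f] card_image[OF f]
    by (simp add: matching_poly_def K_def)
  then have GK: "graph_iso G K"
    using assms K unfolding matching_unique_def comatching_def by metis
  have "{u, v} \<in> edges H \<longleftrightarrow> {f u, f v} \<in> edges K" if "u \<in> verts H" "v \<in> verts H" for u v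
  proof
    assume "{f u, f v} \<in> edges K"
    then obtain e where e: "e \<in> edges H" "f ` e = f ` {u, v}"
      by (auto simp: K_def)
    then have "e = {u, v}"
      using inj_on_image_eq_iff[OF f sub[OF e(1)], of "{u, v}"] that by simp
    then show "{u, v} \<in> edges H" using e by simp
  qed (auto simp: K_def intro: image_eqI[of _ _ "{u, v}"])
  then have "graph_iso H K"
    unfolding graph_iso_def using f by (intro exI[of _ f]) (auto simp: K_def bij_betw_def)
  then show ?thesis
    using GK graph_iso_sym graph_iso_trans by blast
qed

end

theory Submission
  imports Defs "HOL-Computational_Algebra.Polynomial_Factorial" "HOL-Computational_Algebra.Field_as_Ring"
begin

text \<open>The matching polynomial of $S(r,s)$ is $x (x^2-1)^{r-1} (x^2-1-s)$, so a graph \<open>H\<close> with the same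
polynomial has $2r+1$ vertices, $r+s$ edges and the roots $\pm 1$ with multiplicity $r-1$, which is
almost as large as $2r+1$ vertices allow.  The proof exploits this through a theorem of Godsil:
deleting the vertices of a path lowers the multiplicity of a real root by at most one
(\<open>dvd_mu_remove_path\<close>).  That theorem rests on two pointwise inequalities on the real line,
\<open>wronskian_ge_square\<close> and \<open>christoffel_darboux_ge_path\<close>: both bound the square of the polynomial
of the smaller graph by an expression of high order at the root.

Consequently a path \<open>P\<close> in \<open>H\<close> has at most five vertices, and what remains after deleting a path on
four or five vertices has so few vertices that its matching polynomial is $x^i (x^2-1)^{r-2}$ with
$i \le 1$; comparing two coefficients, the rest is $r-2$ disjoint edges and $i$ isolated vertices
(\<open>edges_in_matching_if_dvd\<close>).  Let $s \ge 6$ and $2r-1 \le s \le 2r$.  Then \<open>H\<close> has more edges than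
vertices and hence a path on four vertices; if it had none on five, there would be too few edges.
For a path on five vertices, the absence of a path on six leaves only the middle vertex to be joined
to the rest.  Either it is so joined, and then deleting it leaves $r$ disjoint edges, which makes it a hub and
\<open>H\<close> isomorphic to $S(r,s)$; or all other edges lie within the five vertices, and then they number
at least eight, so that $1$ cannot be a root of their matching polynomial
(\<open>card_edges_5_le\<close>).  For $r=1$ the graph has three vertices and deleting a suitable vertex
leaves a single edge.

For $s=3,4,5$ a graph with the same polynomial is, respectively, a 4-cycle with a pendant edge,
$K_4$ minus an edge with a pendant edge at a vertex of degree two, and the disjoint union of
$K_2$ with $K_5$ minus a triangle.\<close>

section \<open>Matching polynomials of induced subgraphs\<close>

locale edge_set =
  fixes E :: "'a set set"
  assumes card_edge: "e \<in> E \<Longrightarrow> card e = 2"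
begin

definition adj :: "'a \<Rightarrow> 'a \<Rightarrow> bool" where "adj u v \<longleftrightarrow> {u, v} \<in> E"

definition edges_in :: "'a set \<Rightarrow> 'a set set" where "edges_in V = {e \<in> E. e \<subseteq> V}"

definition matchings_in :: "'a set \<Rightarrow> 'a set set set" where
  "matchings_in V = {M. M \<subseteq> edges_in V \<and> pairwise disjnt M}"

text \<open>Induced subgraphs of one fixed graph are represented by their vertex sets.  The coefficients are
  real because the multiplicity arguments evaluate at points near a root.\<close>

definition mu :: "'a set \<Rightarrow> real poly" where
  "mu V = map_poly real_of_int (matching_poly (V, edges_in V))"

lemma adj_sym: "adj u v \<longleftrightarrow> adj v u"
  by (simp add: adj_def insert_commute)

lemma adj_irrefl [simp]: "\<not> adj u u"
  using card_edge[of "{u}"] by (auto simp: adj_def)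

lemma edge_cases:
  assumes "e \<in> E" obtains u v where "e = {u, v}" "u \<noteq> v" "adj u v"
  using card_edge[OF assms] assms unfolding card_2_iff adj_def by blast

lemma edges_inE:
  assumes "e \<in> edges_in V" obtains u v where "e = {u, v}" "u \<in> V" "v \<in> V" "u \<noteq> v" "adj u v"
  using assms by (auto simp: edges_in_def elim: edge_cases)

lemma doubleton_in_edges_in: "{u, v} \<in> edges_in V \<longleftrightarrow> adj u v \<and> u \<in> V \<and> v \<in> V"
  by (auto simp: edges_in_def adj_def)

lemma edges_in_empty [simp]: "edges_in {} = {}"
  using card_edge by (fastforce simp: edges_in_def)

lemma finite_edges_in: "finite V \<Longrightarrow> finite (edges_in V)"
  by (rule finite_subset[of _ "Pow V"]) (auto simp: edges_in_def)

lemma finite_matchings_in: "finite V \<Longrightarrow> finite (matchings_in V)"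
  by (rule finite_subset[of _ "Pow (edges_in V)"]) (auto simp: matchings_in_def finite_edges_in)

lemma edges_in_mono: "U \<subseteq> V \<Longrightarrow> edges_in U \<subseteq> edges_in V"
  by (auto simp: edges_in_def)

lemma card_Union_matching:
  assumes "finite V" "M \<in> matchings_in V"
  shows "card (\<Union>M) = 2 * card M"
proof -
  have M: "M \<subseteq> edges_in V" "pairwise disjnt M"
    using assms by (auto simp: matchings_in_def)
  have c: "card e = 2" if "e \<in> M" for e
    using M that card_edge by (auto simp: edges_in_def)
  have "card (\<Union>M) = sum card M"
    by (rule card_Union_disjoint) (use M c in \<open>auto intro!: card_ge_0_finite\<close>)
  also have "\<dots> = (\<Sum>e\<in>M. 2)"
    by (rule sum.cong) (use c in auto)
  finally show ?thesis by simp
qed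

lemma card_matching_le:
  assumes "finite V" "M \<in> matchings_in V"
  shows "2 * card M \<le> card V"
proof -
  have "\<Union>M \<subseteq> V"
    using assms by (auto simp: matchings_in_def edges_in_def)
  then show ?thesis
    using card_Union_matching[OF assms] card_mono[OF assms(1)] by metis
qed

lemma matchings_induced:
  "matchings (V, edges_in V) k = {M \<in> matchings_in V. card M = k}"
  by (auto simp: matchings_def matchings_in_def pairwise_def disjnt_def)

lemma mu_eq_sum:
  "mu V = (\<Sum>k\<le>card V div 2.
     monom ((-1) ^ k * real (num_matchings (V, edges_in V) k)) (card V - 2 * k))"
  unfolding mu_def matching_poly_def
  by (rule poly_eqI) (simp add: coeff_map_poly coeff_sum if_distrib cong: if_cong)

lemma poly_mu:
  assumes "finite V"
  shows "poly (mu V) x = (\<Sum>M\<in>matchings_in V. (-1) ^ card M * x ^ (card V - 2 * card M))"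
proof -
  let ?n = "card V"
  have "(\<Sum>M\<in>matchings_in V. (-1) ^ card M * x ^ (?n - 2 * card M)) =
      (\<Sum>k\<le>?n div 2. \<Sum>M | M \<in> matchings_in V \<and> card M = k. (-1) ^ card M * x ^ (?n - 2 * card M))"
    using card_matching_le[OF assms]
    by (intro sum.group[symmetric]) (auto simp: finite_matchings_in[OF assms], fastforce)
  also have "\<dots> = (\<Sum>k\<le>?n div 2. (-1) ^ k * real (num_matchings (V, edges_in V) k) * x ^ (?n - 2 * k))"
  proof (rule sum.cong)
    fix k
    have "(\<Sum>M | M \<in> matchings_in V \<and> card M = k. (-1) ^ card M * x ^ (?n - 2 * card M)) =
      (\<Sum>M | M \<in> matchings_in V \<and> card M = k. (-1) ^ k * x ^ (?n - 2 * k))"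
      by (rule sum.cong) auto
    then show "(\<Sum>M | M \<in> matchings_in V \<and> card M = k. (-1) ^ card M * x ^ (?n - 2 * card M)) =
      (-1) ^ k * real (num_matchings (V, edges_in V) k) * x ^ (?n - 2 * k)"
      by (simp add: num_matchings_def matchings_induced)
  qed simp
  finally show ?thesis
    by (simp add: mu_eq_sum poly_sum poly_monom)
qed

lemma mu_empty [simp]: "mu {} = 1"
proof -
  have "matchings_in {} = {{}}"
    by (auto simp: matchings_in_def)
  then have "poly (mu {}) = poly 1"
    by (intro ext) (simp add: poly_mu)
  then show ?thesis by (simp only: poly_eq_poly_eq_iff)
qed

text \<open>A matching either misses \<open>v\<close> or contains exactly one edge \<open>{v, w}\<close>.\<close>

lemma mu_rec:
  assumes "finite V" "v \<in> V"
  shows "mu V = [:0, 1:] * mu (V - {v}) - (\<Sum>w | w \<in> V \<and> adj v w. mu (V - {v, w}))"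
proof -
  let ?N = "{w. w \<in> V \<and> adj v w}" and ?n = "card V"
  let ?A = "matchings_in (V - {v})"
  let ?B = "\<lambda>w. insert {v, w} ` matchings_in (V - {v, w})"
  have finN: "finite ?N" using assms by simp
  have split: "matchings_in V = ?A \<union> (\<Union>w\<in>?N. ?B w)"
  proof (intro equalityI subsetI)
    fix M assume M: "M \<in> matchings_in V"
    show "M \<in> ?A \<union> (\<Union>w\<in>?N. ?B w)"
    proof (cases "v \<in> \<Union>M")
      case False
      then show ?thesis using M by (auto simp: matchings_in_def edges_in_def)
    next
      case True
      then obtain e where e: "e \<in> M" "v \<in> e" by blast
      then have "e \<in> edges_in V" using M by (auto simp: matchings_in_def)
      then obtain w where w: "e = {v, w}" "w \<in> V" "adj v w"
        using e(2) by (metis edges_inE adj_sym insert_commute insertE singletonD)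
      have "f \<inter> e = {}" if "f \<in> M" "f \<noteq> e" for f
        using M e(1) that by (auto simp: matchings_in_def pairwise_def disjnt_def)
      then have "M - {e} \<in> matchings_in (V - {v, w})"
        using M w(1) by (fastforce simp: matchings_in_def edges_in_def pairwise_def)
      moreover have "M = insert {v, w} (M - {e})" using e w by blast
      ultimately show ?thesis using w by blast
    qed
  next
    fix M assume "M \<in> ?A \<union> (\<Union>w\<in>?N. ?B w)"
    then show "M \<in> matchings_in V"
    proof
      assume "M \<in> ?A"
      then show ?thesis by (auto simp: matchings_in_def edges_in_def)
    next
      assume "M \<in> (\<Union>w\<in>?N. ?B w)"
      then obtain w N where w: "w \<in> V" "adj v w" "M = insert {v, w} N" "N \<in> matchings_in (V - {v, w})"
        by blast
      have "disjnt f {v, w}" if "f \<in> N" for f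
        using that w(4) by (auto simp: matchings_in_def edges_in_def disjnt_def)
      then show ?thesis
        using w assms(2)
        by (auto simp: matchings_in_def pairwise_insert doubleton_in_edges_in disjnt_sym)
          (auto simp: edges_in_def)
    qed
  qed
  have notin: "{v, w} \<notin> M" if "M \<in> matchings_in (V - {v, w'})" for M w w'
    using that by (auto simp: matchings_in_def edges_in_def)
  have disj1: "?A \<inter> (\<Union>w\<in>?N. ?B w) = {}"
    by (auto simp: matchings_in_def edges_in_def)
  have disj2: "?B w \<inter> ?B w' = {}" if "w \<noteq> w'" for w w'
  proof -
    have False if M: "M \<in> ?B w" "M \<in> ?B w'" for M
    proof -
      have "{v, w} \<in> M" using M(1) by blast
      moreover obtain N where "M = insert {v, w'} N" "N \<in> matchings_in (V - {v, w'})"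
        using M(2) by blast
      ultimately show False using notin[of N w' w] \<open>w \<noteq> w'\<close> by (auto simp: doubleton_eq_iff)
    qed
    then show ?thesis by blast
  qed
  have "poly (mu V) x = poly ([:0, 1:] * mu (V - {v}) - (\<Sum>w\<in>?N. mu (V - {v, w}))) x" for x
  proof -
    let ?t = "\<lambda>n M. (-1) ^ card M * x ^ (n - 2 * card M)"
    have A: "(\<Sum>M\<in>?A. ?t ?n M) = x * poly (mu (V - {v})) x"
    proof -
      have "?t ?n M = x * ?t (?n - 1) M" if "M \<in> ?A" for M
      proof -
        have "2 * card M \<le> ?n - 1" "?n > 0"
          using card_matching_le[OF _ that] assms by (auto simp: card_gt_0_iff)
        then have "?n - 2 * card M = Suc (?n - 1 - 2 * card M)" by simp
        then show ?thesis by simp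
      qed
      then show ?thesis
        using assms by (simp add: poly_mu sum_distrib_left mult_ac)
    qed
    have B: "(\<Sum>M\<in>?B w. ?t ?n M) = - poly (mu (V - {v, w})) x" if "w \<in> ?N" for w
    proof -
      have "inj_on (insert {v, w}) (matchings_in (V - {v, w}))"
        using notin[of _ w w] by (intro inj_onI) (metis insert_ident)
      then have "(\<Sum>M\<in>?B w. ?t ?n M) = (\<Sum>M\<in>matchings_in (V - {v, w}). ?t ?n (insert {v, w} M))"
        by (simp add: sum.reindex)
      also have "\<dots> = (\<Sum>M\<in>matchings_in (V - {v, w}). - ?t (?n - 2) M)"
      proof (rule sum.cong)
        fix M assume M: "M \<in> matchings_in (V - {v, w})"
        have "finite M"
          using M finite_subset[OF _ finite_edges_in[of "V - {v, w}"]] assms(1)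
          by (auto simp: matchings_in_def)
        then have "card (insert {v, w} M) = Suc (card M)"
          using notin[OF M] by simp
        then show "?t ?n (insert {v, w} M) = - ?t (?n - 2) M"
          by (simp add: algebra_simps)
      qed simp
      also have "\<dots> = - poly (mu (V - {v, w})) x"
      proof -
        have "v \<noteq> w" using that by auto
        then have "card (V - {v, w}) = ?n - 2"
          using that assms by (simp add: card_Diff_subset)
        then show ?thesis using assms by (simp add: poly_mu sum_negf)
      qed
      finally show ?thesis .
    qed
    have "poly (mu V) x = (\<Sum>M\<in>?A. ?t ?n M) + (\<Sum>M\<in>(\<Union>w\<in>?N. ?B w). ?t ?n M)"
      unfolding poly_mu[OF assms(1)] split
      by (rule sum.union_disjoint) (use assms disj1 finN in \<open>auto simp: finite_matchings_in\<close>)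
    also have "(\<Sum>M\<in>(\<Union>w\<in>?N. ?B w). ?t ?n M) = (\<Sum>w\<in>?N. \<Sum>M\<in>?B w. ?t ?n M)"
      by (rule sum.UNION_disjoint) (use assms disj2 in \<open>auto simp: finite_matchings_in\<close>)
    also have "\<dots> = (\<Sum>w\<in>?N. - poly (mu (V - {v, w})) x)"
      by (rule sum.cong) (use B in auto)
    finally show ?thesis
      using A by (simp add: poly_sum sum_negf)
  qed
  then show ?thesis
    by (intro poly_eq_poly_eq_iff[THEN iffD1] ext)
qed

lemma coeff_mu:
  assumes "2 * k \<le> card V"
  shows "coeff (mu V) (card V - 2 * k) = (-1) ^ k * real (num_matchings (V, edges_in V) k)"
proof -
  have *: "card V - 2 * j = card V - 2 * k \<longleftrightarrow> j = k" if "j \<le> card V div 2" for j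
    using assms that by presburger
  have "coeff (mu V) (card V - 2 * k) = (\<Sum>j\<le>card V div 2. if j = k then (-1) ^ j * real (num_matchings (V, edges_in V) j) else 0)"
    unfolding mu_eq_sum coeff_sum coeff_monom by (rule sum.cong) (use * in auto)
  also have "\<dots> = (-1) ^ k * real (num_matchings (V, edges_in V) k)"
    using assms by (subst sum.delta) auto
  finally show ?thesis .
qed

lemma num_matchings_induced_0: "finite V \<Longrightarrow> num_matchings (V, edges_in V) 0 = 1"
  by (rule num_matchings_0) (auto simp: simple_graph_def edges_in_def card_edge)

lemma num_matchings_induced_1: "num_matchings (V, edges_in V) 1 = card (edges_in V)"
proof -
  have "matchings (V, edges_in V) 1 = (\<lambda>e. {e}) ` edges_in V"
    by (auto simp: matchings_def card_1_singleton_iff)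
  then show ?thesis by (simp add: num_matchings_def card_image)
qed

lemma degree_mu:
  assumes "finite V" shows "degree (mu V) = card V"
proof (rule antisym)
  show "degree (mu V) \<le> card V"
    unfolding mu_eq_sum by (intro degree_sum_le) (auto intro: order.trans[OF degree_monom_le])
  show "card V \<le> degree (mu V)"
    using coeff_mu[of 0 V] num_matchings_induced_0[OF assms] by (intro le_degree) simp
qed

lemma lead_coeff_mu:
  assumes "finite V" shows "lead_coeff (mu V) = 1"
  using coeff_mu[of 0 V] num_matchings_induced_0[OF assms] by (simp add: degree_mu[OF assms])

lemma mu_nonzero: "finite V \<Longrightarrow> mu V \<noteq> 0"
  using lead_coeff_mu by fastforce

end

section \<open>Root multiplicities under removal of a path\<close>

text \<open>Near \<open>a\<close> the square cannot exceed a function that vanishes to order \<open>2 * k - 1\<close>, so it vanishes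
  to order at least \<open>2 * k\<close>, its order being even.\<close>

lemma dvd_power_of_square_le:
  fixes p h :: "real poly"
  assumes le: "\<And>x. (poly p x)\<^sup>2 \<le> poly h x" and dvd: "[:-a, 1:] ^ (2 * k - 1) dvd h"
  shows "[:-a, 1:] ^ k dvd p"
  using dvd
proof (induction k)
  case 0
  show ?case by simp
next
  case (Suc k)
  let ?l = "[:-a, 1:]"
  have "?l ^ (2 * k) dvd h"
    using Suc.prems by (rule power_le_dvd) simp
  then have "?l ^ (2 * k - 1) dvd h"
    by (rule power_le_dvd) simp
  then obtain q where q: "p = ?l ^ k * q"
    using Suc.IH by (auto elim: dvdE)
  obtain g where g: "h = ?l ^ (2 * k) * (?l * g)"
  proof -
    obtain g where "h = ?l ^ Suc (2 * k) * g" using Suc.prems by (auto elim: dvdE)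
    then show ?thesis by (intro that[of g]) (simp only: power_Suc2 mult.assoc)
  qed
  (* Away from a, the common even power of x - a is positive and cancels; the value at a follows
     by continuity. *)
  have ineq: "(poly q x)\<^sup>2 \<le> poly (?l * g) x" if "x \<noteq> a" for x
  proof -
    have "(x - a) ^ (2 * k) * (poly q x)\<^sup>2 \<le> (x - a) ^ (2 * k) * poly (?l * g) x"
      using le[of x] unfolding q g by (simp add: power_mult_distrib power_even_eq[symmetric] mult_ac del: mult_pCons_left)
    moreover have "(x - a) ^ (2 * k) > 0" using that by (simp add: power_mult)
    ultimately show ?thesis by (simp add: mult_le_cancel_left_pos del: poly_mult)
  qed
  have "(poly q a)\<^sup>2 \<le> poly (?l * g) a"
  proof (rule tendsto_le[of "at a"])
    show "((\<lambda>x. (poly q x)\<^sup>2) \<longlongrightarrow> (poly q a)\<^sup>2) (at a)"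
      by (intro tendsto_intros)
    show "((\<lambda>x. poly (?l * g) x) \<longlongrightarrow> poly (?l * g) a) (at a)"
      by (intro tendsto_intros)
    show "\<forall>\<^sub>F x in at a. (poly q x)\<^sup>2 \<le> poly (?l * g) x"
      using ineq by (auto simp: eventually_at_filter)
  qed simp
  then have "poly q a = 0" by simp
  then have "?l dvd q" by (simp add: poly_eq_0_iff_dvd)
  then show ?case unfolding q by (simp only: power_Suc2 mult_dvd_mono dvd_refl)
qed

lemma pderiv_sum: "pderiv (\<Sum>x\<in>A. f x) = (\<Sum>x\<in>A. pderiv (f x))"
  by (induction A rule: infinite_finite_induct) (auto simp: pderiv_add)

lemma power_dvd_pderiv:
  assumes "l ^ Suc k dvd p"
  shows "l ^ k dvd pderiv p"
proof -
  obtain g where "p = l ^ Suc k * g" using assms by (auto elim: dvdE)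
  then have "pderiv p = l ^ k * (l * pderiv g + g * (smult (of_nat (Suc k)) (pderiv l)))"
    by (simp only: pderiv_mult pderiv_power_Suc) (simp add: algebra_simps smult_add_left)
  then show ?thesis by simp
qed

context edge_set begin

text \<open>The quotient of \<open>mu V\<close> by \<open>mu (V - {u})\<close> is \<open>x\<close> minus the sum over the neighbours \<open>w\<close> of \<open>u\<close> of the
  reciprocals of the quotients for \<open>V - {u}\<close> and \<open>w\<close>.  By induction the latter quotients increase
  wherever they are defined, so the former has derivative at least one; this is the statement with
  the denominators cleared.\<close>

lemma wronskian_ge_square:
  assumes "finite V" "u \<in> V"
  shows "(poly (mu (V - {u})) x)\<^sup>2 \<le>
    poly (pderiv (mu V) * mu (V - {u}) - mu V * pderiv (mu (V - {u}))) x"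
  using assms
proof (induction "card V" arbitrary: V u rule: less_induct)
  case less
  let ?N = "{w. w \<in> V \<and> adj u w}"
  let ?q = "poly (mu (V - {u})) x" and ?q' = "poly (pderiv (mu (V - {u}))) x"
  let ?r = "\<lambda>w. poly (mu (V - {u, w})) x" and ?r' = "\<lambda>w. poly (pderiv (mu (V - {u, w}))) x"
  have mu: "poly (mu V) x = x * ?q - (\<Sum>w\<in>?N. ?r w)"
    by (subst mu_rec[OF less.prems]) (simp add: poly_sum)
  have "pderiv (mu V) = mu (V - {u}) + [:0, 1:] * pderiv (mu (V - {u})) - (\<Sum>w\<in>?N. pderiv (mu (V - {u, w})))"
    by (subst mu_rec[OF less.prems]) (simp add: pderiv_diff pderiv_mult pderiv_sum pderiv_pCons)
  then have mu': "poly (pderiv (mu V)) x = ?q + x * ?q' - (\<Sum>w\<in>?N. ?r' w)"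
    by (simp add: poly_sum)
  have "?q' * ?r w - ?q * ?r' w \<ge> 0" if "w \<in> ?N" for w
  proof -
    have w: "w \<in> V - {u}" using that by auto
    have "(?r w)\<^sup>2 \<le> ?q' * ?r w - ?q * ?r' w"
      using less.hyps[OF card_Diff1_less[OF less.prems] _ w] less.prems
      by (simp add: Diff_insert2[symmetric] insert_commute)
    then show ?thesis using zero_le_power2 order_trans by blast
  qed
  then have "0 \<le> (\<Sum>w\<in>?N. ?q' * ?r w - ?q * ?r' w)"
    by (intro sum_nonneg) auto
  also have "\<dots> = ?q' * (\<Sum>w\<in>?N. ?r w) - ?q * (\<Sum>w\<in>?N. ?r' w)"
    by (simp add: sum_subtractf sum_distrib_left)
  finally show ?case
    by (simp add: mu mu' algebra_simps power2_eq_square)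
qed

text \<open>If \<open>mu (V - {u})\<close> had order \<open>j < k\<close> at \<open>a\<close>, the Wronskian would have order at least \<open>k + j > 2 * j\<close>,
  which is more than the order of the square below it.\<close>

lemma dvd_mu_remove_vertex:
  assumes "finite V" "u \<in> V" "[:-a, 1:] ^ Suc k dvd mu V"
  shows "[:-a, 1:] ^ k dvd mu (V - {u})"
proof -
  let ?l = "[:-a, 1:]" and ?p = "mu V" and ?q = "mu (V - {u})"
  have "?l ^ j dvd ?q" if "j \<le> k" for j
    using that
  proof (induction j)
    case 0
    show ?case by simp
  next
    case (Suc j)
    have IH: "?l ^ j dvd ?q" using Suc by simp
    have "?l ^ k dvd pderiv ?p"
      using assms(3) by (rule power_dvd_pderiv)
    then have 1: "?l ^ (k + j) dvd pderiv ?p * ?q"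
      unfolding power_add using IH by (rule mult_dvd_mono)
    have "?l ^ (j - 1) dvd pderiv ?q"
    proof (cases j)
      case j: (Suc i)
      then show ?thesis
        using IH by (auto intro: power_dvd_pderiv)
    qed simp
    then have 2: "?l ^ (Suc k + (j - 1)) dvd ?p * pderiv ?q"
      unfolding power_add by (intro mult_dvd_mono) (use assms(3) in simp_all)
    have "?l ^ (2 * Suc j - 1) dvd pderiv ?p * ?q - ?p * pderiv ?q"
      by (rule dvd_diff[OF power_le_dvd[OF 1] power_le_dvd[OF 2]]) (use Suc.prems in auto)
    then show ?case
      using wronskian_ge_square[OF assms(1,2)] by (rule dvd_power_of_square_le[rotated])
  qed
  then show ?thesis by simp
qed

definition path :: "'a list \<Rightarrow> bool" where
  "path xs \<longleftrightarrow> distinct xs \<and> successively adj xs"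

text \<open>The expression on the left satisfies a recursion along the first edge of a path from \<open>u\<close> to \<open>v\<close>,
  obtained by expanding both \<open>mu V\<close> and \<open>mu (V - {v})\<close> at \<open>u\<close>.\<close>

lemma christoffel_darboux:
  assumes "finite V" "u \<in> V" "v \<in> V" "u \<noteq> v"
  shows "mu (V - {u}) * mu (V - {v}) - mu V * mu (V - {u, v}) =
    (if adj u v then (mu (V - {u, v}))\<^sup>2 else 0) +
    (\<Sum>w | w \<in> V - {u, v} \<and> adj u w.
      mu (V - {u} - {w}) * mu (V - {u} - {v}) - mu (V - {u}) * mu (V - {u} - {w, v}))"
proof -
  let ?N = "{w. w \<in> V - {u, v} \<and> adj u w}" and ?X = "[:0, 1:] :: real poly"
  let ?a = "if adj u v then mu (V - {u, v}) else 0"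
  have "{w. w \<in> V \<and> adj u w} = (if adj u v then insert v ?N else ?N)"
    using assms by auto
  then have 1: "mu V = ?X * mu (V - {u}) - ?a - (\<Sum>w\<in>?N. mu (V - {u, w}))"
    using assms by (subst mu_rec[OF assms(1,2)]) simp
  have "{w. w \<in> V - {v} \<and> adj u w} = ?N"
    using assms by auto
  then have 2: "mu (V - {v}) = ?X * mu (V - {u, v}) - (\<Sum>w\<in>?N. mu (V - {u, w, v}))"
    using mu_rec[of "V - {v}" u] assms by (simp add: Diff_insert2[symmetric] insert_commute)
  have 3: "V - {u} - {w} = V - {u, w}" "V - {u} - {w, v} = V - {u, w, v}" for w
    by auto
  show ?thesis
    unfolding 3 by (subst 1, subst 2)
      (simp add: algebra_simps power2_eq_square sum_subtractf sum_distrib_left del: mult_pCons_left)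
qed

text \<open>Unfolding the recursion of \<open>christoffel_darboux\<close> to the end would express the left-hand side as the sum of
  \<open>(mu (V - set P))\<^sup>2\<close> over all paths \<open>P\<close> from \<open>u\<close> to \<open>v\<close>; the next two lemmas extract its
  nonnegativity and the contribution of a single path.\<close>

lemma christoffel_darboux_nonneg:
  assumes "finite V" "u \<in> V" "v \<in> V" "u \<noteq> v"
  shows "0 \<le> poly (mu (V - {u}) * mu (V - {v}) - mu V * mu (V - {u, v})) x"
  using assms
proof (induction "card V" arbitrary: V u rule: less_induct)
  case less
  have "0 \<le> poly (mu (V - {u} - {w}) * mu (V - {u} - {v}) - mu (V - {u}) * mu (V - {u} - {w, v})) x"
    if "w \<in> V - {u, v}" for w
    using less.hyps[OF card_Diff1_less[OF less.prems(1,2)], of w] less.prems that by simp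
  then show ?case
    unfolding christoffel_darboux[OF less.prems]
    by (auto simp: poly_sum simp del: poly_diff poly_mult intro!: add_nonneg_nonneg sum_nonneg)
qed

lemma christoffel_darboux_ge_path:
  assumes "finite V" "path (u # w # xs)" "set (u # w # xs) \<subseteq> V"
  defines "v \<equiv> last (w # xs)"
  shows "(poly (mu (V - set (u # w # xs))) x)\<^sup>2 \<le>
    poly (mu (V - {u}) * mu (V - {v}) - mu V * mu (V - {u, v})) x"
  using assms(1-3) unfolding v_def
proof (induction xs arbitrary: V u w)
  case Nil
  then have uw: "u \<in> V" "w \<in> V" "u \<noteq> w" "adj u w" by (auto simp: path_def)
  have "0 \<le> poly (mu (V - {u} - {w'}) * mu (V - {u} - {w}) - mu (V - {u}) * mu (V - {u} - {w', w})) x"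
    if "w' \<in> V - {u, w}" for w'
    using christoffel_darboux_nonneg[of "V - {u}" w' w] that Nil uw by simp
  then show ?case
    using christoffel_darboux[OF Nil(1) uw(1-3)] uw
    by (auto simp: poly_sum simp del: poly_diff poly_mult intro!: sum_nonneg)
next
  case (Cons z xs)
  define v where "v = last (z # xs)"
  have v: "v \<in> set (z # xs)" unfolding v_def by (rule last_in_set) simp
  then have uv: "u \<in> V" "v \<in> V" "u \<noteq> v" "w \<in> V" "w \<noteq> v" "w \<noteq> u" "adj u w"
    using Cons.prems by (auto simp: path_def)
  let ?W = "\<lambda>w'. poly (mu (V - {u} - {w'}) * mu (V - {u} - {v}) - mu (V - {u}) * mu (V - {u} - {w', v})) x"
  have nn: "0 \<le> ?W w'" if "w' \<in> V - {u, v}" for w'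
    using christoffel_darboux_nonneg[of "V - {u}" w' v] that Cons.prems uv by simp
  have "path (w # z # xs)" "set (w # z # xs) \<subseteq> V - {u}"
    using Cons.prems by (auto simp: path_def)
  then have "(poly (mu (V - {u} - set (w # z # xs))) x)\<^sup>2 \<le> ?W w"
    using Cons.IH[of "V - {u}" w z] Cons.prems(1) unfolding v_def by simp
  also have "\<dots> \<le> (\<Sum>w' | w' \<in> V - {u, v} \<and> adj u w'. ?W w')"
    using nn uv Cons.prems(1) by (intro member_le_sum) auto
  also have "\<dots> \<le> poly (mu (V - {u}) * mu (V - {v}) - mu V * mu (V - {u, v})) x"
    unfolding christoffel_darboux[OF Cons.prems(1) uv(1-3)] by (simp add: poly_sum)
  also have "V - {u} - set (w # z # xs) = V - set (u # w # z # xs)" by auto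
  finally show ?case by (simp add: v_def)
qed

text \<open>Godsil's theorem.  With \<open>u\<close> and \<open>v\<close> the ends of the path, deleting one vertex costs at most one factor
  and deleting two costs at most two, so both products in \<open>christoffel_darboux_ge_path\<close> are
  divisible by the power \<open>2 * k\<close>.\<close>

lemma dvd_mu_remove_path:
  assumes V: "finite V" and xs: "path xs" "set xs \<subseteq> V" "xs \<noteq> []"
    and dvd: "[:-a, 1:] ^ Suc k dvd mu V"
  shows "[:-a, 1:] ^ k dvd mu (V - set xs)"
proof -
  consider u where "xs = [u]" | u w ys where "xs = u # w # ys"
    using xs(3) by (metis list.exhaust)
  then show ?thesis
  proof cases
    case 1
    then show ?thesis using dvd_mu_remove_vertex[OF V _ dvd] xs by simp
  next
    case (2 u w ys)
    define v where "v = last (w # ys)"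
    have "v \<in> set (w # ys)" unfolding v_def by (rule last_in_set) simp
    then have uv: "u \<in> V" "v \<in> V" "u \<noteq> v" using xs 2 by (auto simp: path_def)
    let ?l = "[:-a, 1:]"
    have "?l ^ (2 * k - 1) dvd mu (V - {u}) * mu (V - {v}) - mu V * mu (V - {u, v})"
    proof (cases k)
      case (Suc j)
      have k: "?l ^ k dvd mu (V - {u})" "?l ^ k dvd mu (V - {v})"
        using dvd_mu_remove_vertex[OF V _ dvd] uv by auto
      have "?l ^ j dvd mu (V - {u} - {v})"
        by (rule dvd_mu_remove_vertex) (use V uv k(1) Suc in auto)
      moreover have "V - {u} - {v} = V - {u, v}" by auto
      ultimately have j: "?l ^ j dvd mu (V - {u, v})" by simp
      have k2: "?l ^ (k + k) dvd mu (V - {u}) * mu (V - {v})"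
        unfolding power_add using k by (rule mult_dvd_mono)
      have kk: "?l ^ (Suc k + j) dvd mu V * mu (V - {u, v})"
        unfolding power_add using dvd j by (rule mult_dvd_mono)
      show ?thesis
        by (rule dvd_diff[OF power_le_dvd[OF k2] power_le_dvd[OF kk]]) (use Suc in auto)
    qed simp
    then show ?thesis
    proof (rule dvd_power_of_square_le[rotated])
      show "(poly (mu (V - set xs)) x)\<^sup>2 \<le>
        poly (mu (V - {u}) * mu (V - {v}) - mu V * mu (V - {u, v})) x" for x
        using christoffel_darboux_ge_path[OF V xs(1,2)[unfolded 2]] unfolding 2 v_def .
    qed
  qed
qed

lemma X2_minus_1_power_dvd_iff:
  fixes p :: "real poly"
  shows "[:-1, 0, 1:] ^ k dvd p \<longleftrightarrow> [:-1, 1:] ^ k dvd p \<and> [:-(-1), 1:] ^ k dvd p"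
proof -
  have eq: "[:-1, 0, 1:] = [:-1, 1:] * ([:-(-1), 1:] :: real poly)" by simp
  have "coprime [:-1, 1:] ([:-(-1), 1:] :: real poly)"
  proof (rule coprimeI)
    fix c :: "real poly"
    assume "c dvd [:-1, 1:]" "c dvd [:-(-1), 1:]"
    then have "c dvd [:-(-1), 1:] - [:-1, 1:]" by (intro dvd_diff)
    then have "c dvd [:2:]" by simp
    moreover have "is_unit ([:2:] :: real poly)" by (simp add: is_unit_const_poly_iff dvd_field_iff)
    ultimately show "is_unit c" using dvd_unit_imp_unit by blast
  qed
  then have "coprime ([:-1, 1:] ^ k) ([:-(-1), 1:] ^ k :: real poly)"
    by (simp only: coprime_power_left_iff coprime_power_right_iff simp_thms)
  then show ?thesis
    unfolding eq power_mult_distrib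
    by (auto intro: divides_mult dvd_mult_left dvd_mult_right simp del: mult_pCons_left mult_pCons_right minus_minus)
qed

lemma X2_minus_1_dvd_mu_remove_path:
  assumes "finite V" "path xs" "set xs \<subseteq> V" "xs \<noteq> []" "[:-1, 0, 1:] ^ Suc k dvd mu V"
  shows "[:-1, 0, 1:] ^ k dvd mu (V - set xs)"
  using assms(5) dvd_mu_remove_path[OF assms(1-4), of 1 k] dvd_mu_remove_path[OF assms(1-4), of "-1" k]
  unfolding X2_minus_1_power_dvd_iff by blast

end

section \<open>Matchings and induced subgraphs\<close>

context edge_set begin

text \<open>The induced subgraph is a disjoint union of copies of \<open>K\<^sub>2\<close>: it has a perfect matching and no
  further edges.\<close>

definition matched :: "'a set \<Rightarrow> bool" where
  "matched R \<longleftrightarrow> pairwise disjnt (edges_in R) \<and> \<Union>(edges_in R) = R"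

lemma Union_edges_in_subset: "\<Union>(edges_in V) \<subseteq> V"
  by (auto simp: edges_in_def)

lemma card_edges_in_remove:
  assumes "finite V" "v \<in> V"
  shows "card (edges_in V) = card (edges_in (V - {v})) + card {w \<in> V. adj v w}"
proof -
  let ?N = "{w \<in> V. adj v w}"
  have eq: "edges_in V = edges_in (V - {v}) \<union> (\<lambda>w. {v, w}) ` ?N"
  proof (intro equalityI subsetI)
    fix e assume e: "e \<in> edges_in V"
    show "e \<in> edges_in (V - {v}) \<union> (\<lambda>w. {v, w}) ` ?N"
    proof (cases "v \<in> e")
      case True
      then obtain w where "e = {v, w}" "w \<in> V" "adj v w"
        using e by (metis edges_inE adj_sym insert_commute insertE singletonD)
      then show ?thesis by blast
    qed (use e in \<open>auto simp: edges_in_def\<close>)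
  qed (use assms in \<open>auto simp: doubleton_in_edges_in, auto simp: edges_in_def\<close>)
  have "inj_on (\<lambda>w. {v, w}) ?N"
    by (auto simp: inj_on_def doubleton_eq_iff)
  moreover have "edges_in (V - {v}) \<inter> (\<lambda>w. {v, w}) ` ?N = {}"
    by (auto simp: edges_in_def)
  ultimately show ?thesis
    unfolding eq using assms by (simp add: card_Un_disjoint finite_edges_in card_image)
qed

lemma mate_unique:
  assumes "pairwise disjnt (edges_in R)" "adj a b" "adj a w" "a \<in> R" "b \<in> R" "w \<in> R"
  shows "w = b"
proof (rule ccontr)
  assume "w \<noteq> b"
  then have "{a, b} \<noteq> {a, w}" by (auto simp: doubleton_eq_iff)
  moreover have "{a, b} \<in> edges_in R" "{a, w} \<in> edges_in R"
    using assms by (auto simp: doubleton_in_edges_in)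
  ultimately have "disjnt {a, b} {a, w}"
    using assms(1) by (auto dest: pairwiseD)
  then show False by simp
qed

lemma mate_exists:
  assumes "a \<in> \<Union>(edges_in R)"
  obtains b where "b \<in> R" "adj a b"
  using assms by (metis UnionE edges_inE adj_sym insertE singletonD)

lemma matched_remove_edge:
  assumes "matched R" "a \<in> R" "b \<in> R" "adj a b"
  shows "matched (R - {a, b})" "edges_in R = insert {a, b} (edges_in (R - {a, b}))"
    "{a, b} \<notin> edges_in (R - {a, b})"
proof -
  have ab: "{a, b} \<in> edges_in R" using assms by (simp add: doubleton_in_edges_in)
  have "e \<inter> {a, b} = {}" if "e \<in> edges_in R" "e \<noteq> {a, b}" for e
    using assms(1) ab that by (auto simp: matched_def pairwise_def disjnt_def)
  then have eq: "edges_in (R - {a, b}) = edges_in R - {{a, b}}"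
    by (fastforce simp: edges_in_def)
  then show "edges_in R = insert {a, b} (edges_in (R - {a, b}))"
    "{a, b} \<notin> edges_in (R - {a, b})" using ab by auto
  have "\<Union>(edges_in (R - {a, b})) = R - {a, b}"
  proof
    show "R - {a, b} \<subseteq> \<Union>(edges_in (R - {a, b}))"
      using assms(1) unfolding eq matched_def by blast
  qed (rule Union_edges_in_subset)
  then show "matched (R - {a, b})"
    using assms(1) unfolding eq matched_def by (auto intro: pairwise_subset)
qed

lemma card_Union_edges_in:
  assumes "finite R" "pairwise disjnt (edges_in R)"
  shows "card (\<Union>(edges_in R)) = 2 * card (edges_in R)"
  using card_Union_matching[of R "edges_in R"] assms by (simp add: matchings_in_def)

lemma mu_isolated_edge:
  assumes V: "finite V" "a \<in> V" "b \<in> V" "adj a b"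
    and a: "\<And>w. w \<in> V \<Longrightarrow> adj a w \<Longrightarrow> w = b" and b: "\<And>w. w \<in> V \<Longrightarrow> adj b w \<Longrightarrow> w = a"
  shows "mu V = [:-1, 0, 1:] * mu (V - {a, b})"
proof -
  have "a \<noteq> b" using V by auto
  have 1: "{w. w \<in> V \<and> adj a w} = {b}" using V a by blast
  have 2: "{w. w \<in> V - {a} \<and> adj b w} = {}" using b by blast
  have 3: "mu (V - {a}) = [:0, 1:] * mu (V - {a} - {b})"
    using mu_rec[of "V - {a}" b] V \<open>a \<noteq> b\<close> unfolding 2 by simp
  have "V - {a} - {b} = V - {a, b}" by auto
  then show ?thesis
    using mu_rec[OF V(1,2)] unfolding 1 3 by (simp add: algebra_simps)
qed

lemma mu_Un_matched:
  assumes "finite P" "finite R" "P \<inter> R = {}" "matched R"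
    and "\<And>p r. p \<in> P \<Longrightarrow> r \<in> R \<Longrightarrow> \<not> adj r p"
  shows "mu (P \<union> R) = [:-1, 0, 1:] ^ card (edges_in R) * mu P"
  using assms(2-5)
proof (induction "card R" arbitrary: R rule: less_induct)
  case less
  show ?case
  proof (cases "R = {}")
    case True
    then show ?thesis using True by simp
  next
    case False
    then obtain a where a: "a \<in> R" by blast
    then have "a \<in> \<Union>(edges_in R)" using less.prems by (simp add: matched_def)
    then obtain b where b: "b \<in> R" "adj a b" by (rule mate_exists)
    have disj: "pairwise disjnt (edges_in R)" using less.prems by (simp add: matched_def)
    note rem = matched_remove_edge[OF less.prems(3) a b]
    have "card (R - {a, b}) < card R"
      using a less.prems(1) by (intro psubset_card_mono) auto
    then have IH: "mu (P \<union> (R - {a, b})) = [:-1, 0, 1:] ^ card (edges_in (R - {a, b})) * mu P"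
      using less.prems rem(1) by (intro less.hyps) auto
    have "mu (P \<union> R) = [:-1, 0, 1:] * mu (P \<union> R - {a, b})"
    proof (rule mu_isolated_edge)
      show "w = b" if "w \<in> P \<union> R" "adj a w" for w
        using that less.prems(4) a b mate_unique[OF disj] by blast
      show "w = a" if "w \<in> P \<union> R" "adj b w" for w
        using that less.prems(4) a b mate_unique[OF disj, of b a w] adj_sym[of a b] by blast
    qed (use assms(1) less.prems a b in auto)
    also have "P \<union> R - {a, b} = P \<union> (R - {a, b})" using less.prems(2) a b by auto
    also have "card (edges_in R) = Suc (card (edges_in (R - {a, b})))"
      unfolding rem(2) using rem(3) less.prems(1) by (subst card_insert_disjoint) (auto intro: finite_edges_in)
    ultimately show ?thesis unfolding IH by (simp only: power_Suc mult.assoc)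
  qed
qed

lemma mu_singleton: "mu {a} = [:0, 1:]"
proof -
  have "{w. w \<in> {a} \<and> adj a w} = {}" by auto
  then show ?thesis using mu_rec[of "{a}" a] by simp
qed

text \<open>The matching polynomial of any graph that becomes a disjoint union of \<open>Suc k\<close> edges when a vertex
  \<open>c\<close> is deleted depends only on the degree of \<open>c\<close>: for each neighbour \<open>w\<close> of \<open>c\<close>, deleting both
  leaves \<open>k\<close> edges and the isolated mate of \<open>w\<close>.\<close>

lemma mu_hub:
  assumes V: "finite V" "c \<in> V" "matched (V - {c})"
    and r: "card (edges_in (V - {c})) = Suc k"
  shows "mu V = [:0, 1:] * [:-1, 0, 1:] ^ k * ([:-1, 0, 1:] - [:of_nat (card {w \<in> V. adj c w}):])"
proof -
  let ?q = "[:-1, 0, 1:] :: real poly" and ?N = "{w \<in> V. adj c w}"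
  have "mu (V - {c}) = ?q ^ Suc k"
    using mu_Un_matched[of "{}" "V - {c}"] V r by simp
  moreover have "mu (V - {c, w}) = ?q ^ k * [:0, 1:]" if "w \<in> ?N" for w
  proof -
    have w: "w \<in> V - {c}" using that by auto
    then have "w \<in> \<Union>(edges_in (V - {c}))" using V by (simp add: matched_def)
    then obtain b where b: "b \<in> V - {c}" "adj w b" by (rule mate_exists)
    have disj: "pairwise disjnt (edges_in (V - {c}))" using V by (simp add: matched_def)
    note rem = matched_remove_edge[OF V(3) w b]
    have "mu ({b} \<union> (V - {c} - {w, b})) = ?q ^ card (edges_in (V - {c} - {w, b})) * mu {b}"
    proof (rule mu_Un_matched)
      show "\<not> adj u p" if "p \<in> {b}" "u \<in> V - {c} - {w, b}" for p u
        using mate_unique[OF disj, of b w u] that w b adj_sym[of w b] adj_sym[of u b] by blast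
    qed (use V rem in auto)
    also have "{b} \<union> (V - {c} - {w, b}) = V - {c, w}"
      using b by auto
    also have "card (edges_in (V - {c} - {w, b})) = k"
      using r rem(2,3) V(1) by (simp add: finite_edges_in)
    finally show ?thesis by (simp only: mu_singleton)
  qed
  ultimately have "mu V = [:0, 1:] * ?q ^ Suc k - (\<Sum>w\<in>?N. ?q ^ k * [:0, 1:])"
    by (subst mu_rec[OF V(1,2)]) (simp del: mult_pCons_left mult_pCons_right)
  also have "\<dots> = [:0, 1:] * ?q ^ k * (?q - of_nat (card ?N))"
    by (simp add: algebra_simps del: mult_pCons_left mult_pCons_right)
  finally show ?thesis by (simp add: of_nat_poly)
qed

lemma coeff_X2_minus_1_power:
  "coeff ([:-1, 0, 1:] ^ k :: real poly) (2 * k) = 1"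
  "coeff ([:-1, 0, 1:] ^ Suc k :: real poly) (2 * k) = - real (Suc k)"
  "coeff ([:-1, 0, 1:] ^ k :: real poly) 0 = (-1) ^ k"
proof -
  have deg: "degree ([:-1, 0, 1:] ^ n :: real poly) = 2 * n" for n
    by (simp add: degree_power_eq)
  show 1: "coeff ([:-1, 0, 1:] ^ k :: real poly) (2 * k) = 1" for k
    using deg[of k] lead_coeff_power[of "[:-1, 0, 1:] :: real poly" k] by simp
  show "coeff ([:-1, 0, 1:] ^ Suc k :: real poly) (2 * k) = - real (Suc k)"
  proof (induction k)
    case (Suc k)
    have "coeff ([:-1, 0, 1:] ^ Suc (Suc k) :: real poly) (2 * Suc k) =
      - coeff ([:-1, 0, 1:] ^ Suc k :: real poly) (2 * Suc k) + coeff ([:-1, 0, 1:] ^ Suc k :: real poly) (2 * k)"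
      by (subst power_Suc) (simp add: coeff_pCons del: power_Suc)
    then show ?case using Suc 1[of "Suc k"] by simp
  qed simp
  show "coeff ([:-1, 0, 1:] ^ k :: real poly) 0 = (-1) ^ k"
    by (simp add: coeff_0_power)
qed

text \<open>Being monic of degree \<open>2 * k + i\<close>, the polynomial is \<open>(X\<^sup>2 - 1)\<^sup>k\<close> times a monic polynomial of degree
  \<open>i\<close>, which for \<open>i = 1\<close> is \<open>X\<close> by parity.  The coefficient after the leading one counts the edges and
  the last nonzero one counts the \<open>k\<close>-matchings, so there are \<open>k\<close> edges and one matching uses them all.\<close>

lemma edges_in_matching_if_dvd:
  assumes R: "finite R" "card R = 2 * k + i" "i \<le> 1" and dvd: "[:-1, 0, 1:] ^ k dvd mu R"
  shows "pairwise disjnt (edges_in R)" "card (edges_in R) = k"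
proof -
  let ?q = "[:-1, 0, 1:] :: real poly"
  obtain g where g: "mu R = ?q ^ k * g" using dvd by (auto elim: dvdE)
  have "g \<noteq> 0" using g mu_nonzero[OF R(1)] by auto
  have degq: "degree (?q ^ k) = 2 * k" by (simp add: degree_power_eq)
  have "degree (mu R) = 2 * k + degree g"
    unfolding g using \<open>g \<noteq> 0\<close> degq by (subst degree_mult_eq) auto
  then have degg: "degree g = i" using degree_mu[OF R(1)] R(2) by simp
  have "lead_coeff (mu R) = lead_coeff (?q ^ k) * lead_coeff g"
    unfolding g by (rule lead_coeff_mult)
  then have lcg: "coeff g i = 1"
    using lead_coeff_mu[OF R(1)] degg degq coeff_X2_minus_1_power(1)[of k] by simp
  have "g = monom 1 i"
  proof (cases "i = 0")
    case True
    then show ?thesis using degg lcg by (auto simp: monom_0 elim: degree_eq_zeroE)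
  next
    case False
    then have i: "i = 1" using R(3) by simp
    (* The order is odd, so every matching misses a vertex and contributes a positive power of x. *)
    have "poly (mu R) 0 = 0"
      unfolding poly_mu[OF R(1)]
    proof (rule sum.neutral, intro ballI)
      fix M assume "M \<in> matchings_in R"
      then have "2 * card M \<le> card R"
        by (rule card_matching_le[OF R(1)])
      then have "card R - 2 * card M \<noteq> 0"
        using R(2) i by presburger
      then show "(-1) ^ card M * 0 ^ (card R - 2 * card M) = (0::real)" by simp
    qed
    then have "coeff g 0 = 0"
      unfolding g poly_mult poly_power by (simp add: poly_0_coeff_0[symmetric])
    then show ?thesis
      using degg lcg i by (intro poly_eqI) (auto simp: coeff_eq_0 less_Suc_eq nat_neq_iff)
  qed
  then have mpR: "mu R = monom 1 i * ?q ^ k" unfolding g by (simp only: mult.commute)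
  show card: "card (edges_in R) = k"
  proof (cases k)
    case 0
    have "edges_in R = {}"
    proof (rule equals0I)
      fix e assume "e \<in> edges_in R"
      then have "card e = 2" "e \<subseteq> R" using card_edge by (auto simp: edges_in_def)
      then show False using R 0 card_mono[of R e] by simp
    qed
    then show ?thesis using 0 by simp
  next
    case (Suc j)
    have "coeff (mu R) (card R - 2 * 1) = - real k"
      unfolding mpR coeff_monom_mult using R(2) Suc coeff_X2_minus_1_power(2)[of j]
      by (simp del: power_Suc)
    then show ?thesis
      using coeff_mu[of 1 R] R(2) Suc num_matchings_induced_1[of R] by simp
  qed
  have "coeff (mu R) (card R - 2 * k) = (-1) ^ k"
    unfolding mpR coeff_monom_mult using R(2) coeff_X2_minus_1_power(3)[of k] by simp
  then have "num_matchings (R, edges_in R) k = 1"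
    using coeff_mu[of k R] R(2) by simp
  then have "matchings (R, edges_in R) k \<noteq> {}"
    by (auto simp: num_matchings_def)
  then obtain M where M: "M \<in> matchings_in R" "card M = k"
    unfolding matchings_induced by blast
  then have "M = edges_in R"
    using card card_subset_eq[OF finite_edges_in[OF R(1)], of M] by (auto simp: matchings_in_def)
  then show "pairwise disjnt (edges_in R)" using M by (auto simp: matchings_in_def)
qed

text \<open>The components of such a graph are stars and triangles.  In the induction, a vertex with two
  neighbours either lies in a triangle, which then is a component with as many edges as vertices, or
  has a neighbour of degree one.\<close>

lemma card_edges_le_if_no_P4:
  assumes "finite V" "\<And>a b c d. path [a, b, c, d] \<Longrightarrow> {a, b, c, d} \<subseteq> V \<Longrightarrow> False"
  shows "card (edges_in V) \<le> card V"
  using assms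
proof (induction "card V" arbitrary: V rule: less_induct)
  case less
  show ?case
  proof (cases "V = {}")
    case True
    then show ?thesis using True by simp
  next
    case False
    have rem1: ?thesis if v: "v \<in> V" "card {w \<in> V. adj v w} \<le> 1" for v
    proof -
      have "card (V - {v}) < card V" using v less.prems by (intro card_Diff1_less)
      then have "card (edges_in (V - {v})) \<le> card (V - {v})"
        using less.prems by (intro less.hyps) auto
      then show ?thesis
        using card_edges_in_remove[OF less.prems(1) v(1)] v less.prems(1)
        by (simp add: card_gt_0_iff) (metis One_nat_def Suc_pred add_mono card_gt_0_iff empty_iff plus_1_eq_Suc add.commute)
    qed
    from False obtain v where v: "v \<in> V" by blast
    show ?thesis
    proof (cases "card {w \<in> V. adj v w} \<le> 1")
      case False
      then obtain a b where ab: "a \<in> V" "b \<in> V" "adj v a" "adj v b" "a \<noteq> b"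
        using less.prems(1) by (auto simp: not_le card_le_Suc0_iff_eq)
      then have ne: "v \<noteq> a" "v \<noteq> b" by auto
      show ?thesis
      proof (cases "adj a b")
        case True
        have nbr: "x \<in> {v, a, b}" if "x \<in> V" "y \<in> {v, a, b}" "adj x y" for x y
        proof (rule ccontr)
          assume "x \<notin> {v, a, b}"
          then have "path [x, v, a, b] \<or> path [x, a, v, b] \<or> path [x, b, v, a]"
            using that ab ne True by (auto simp: path_def adj_sym)
          then show False using less.prems(2) that ab v by blast
        qed
        have "edges_in V \<subseteq> edges_in (V - {v, a, b}) \<union> {{v, a}, {v, b}, {a, b}}"
        proof
          fix e assume "e \<in> edges_in V"
          then obtain x y where e: "e = {x, y}" "x \<in> V" "y \<in> V" "x \<noteq> y" "adj x y"
            by (rule edges_inE)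
          then show "e \<in> edges_in (V - {v, a, b}) \<union> {{v, a}, {v, b}, {a, b}}"
            using nbr[of x y] nbr[of y x] adj_sym[of x y]
            by (cases "x \<in> {v, a, b}"; cases "y \<in> {v, a, b}") (auto simp: doubleton_in_edges_in)
        qed
        then have "card (edges_in V) \<le> card (edges_in (V - {v, a, b}) \<union> {{v, a}, {v, b}, {a, b}})"
          using less.prems(1) by (intro card_mono) (auto simp: finite_edges_in)
        also have "\<dots> \<le> card (edges_in (V - {v, a, b})) + card {{v, a}, {v, b}, {a, b}}"
          by (rule card_Un_le)
        also have "card {{v, a}, {v, b}, {a, b}} \<le> 3"
          by (simp add: card_insert_if)
        also have "card (edges_in (V - {v, a, b})) \<le> card (V - {v, a, b})"
          using v less.prems by (intro less.hyps psubset_card_mono) auto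
        also have "card (V - {v, a, b}) + 3 = card V"
          using ab v ne less.prems(1) card_mono[of V "{v, a, b}"] by (simp add: card_Diff_subset)
        finally show ?thesis by simp
      next
        case False
        have "x = v" if "x \<in> V" "adj a x" for x
        proof (rule ccontr)
          assume "x \<noteq> v"
          then have "path [x, a, v, b]" using that ab ne False by (auto simp: path_def adj_sym)
          then show False using less.prems(2) that ab v by blast
        qed
        then have "{w \<in> V. adj a w} \<subseteq> {v}" by auto
        then have "card {w \<in> V. adj a w} \<le> 1"
          using card_mono[of "{v}" "{w \<in> V. adj a w}"] by simp
        then show ?thesis using rem1 ab by blast
      qed
    qed (use rem1 v in blast)
  qed
qed

end

section \<open>Finding the hub\<close>

context edge_set begin

text \<open>Numerical indicators turn the matching numbers of a graph with few vertices into polynomial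
  expressions that linear arithmetic can bound.\<close>

definition adj_ind :: "'a \<Rightarrow> 'a \<Rightarrow> real" where
  "adj_ind u v = of_bool (adj u v)"

lemma poly_mu_insert:
  assumes "finite V" "v \<notin> V"
  shows "poly (mu (insert v V)) x = x * poly (mu V) x - (\<Sum>w\<in>V. adj_ind v w * poly (mu (V - {w})) x)"
proof -
  have "(\<Sum>w\<in>V. adj_ind v w * poly (mu (V - {w})) x) = (\<Sum>w | w \<in> V \<and> adj v w. poly (mu (V - {w})) x)"
    using assms(1) by (simp add: adj_ind_def sum.inter_filter[symmetric] of_bool_def if_distrib[of "\<lambda>c. c * _"] cong: if_cong)
  moreover have "{w. w \<in> insert v V \<and> adj v w} = {w. w \<in> V \<and> adj v w}" by auto
  moreover have "insert v V - {v, w} = V - {w}" for w using assms by auto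
  ultimately show ?thesis
    using assms by (subst mu_rec[of _ v]) (auto simp: poly_sum)
qed

lemma card_edges_in_insert:
  assumes "finite V" "v \<notin> V"
  shows "real (card (edges_in (insert v V))) = real (card (edges_in V)) + (\<Sum>w\<in>V. adj_ind v w)"
proof -
  have "(\<Sum>w\<in>V. adj_ind v w) = real (card {w \<in> V. adj v w})"
    using assms(1) by (simp add: adj_ind_def of_bool_def sum.inter_filter[symmetric])
  moreover have "{w \<in> insert v V. adj v w} = {w \<in> V. adj v w}" by auto
  moreover have "insert v V - {v} = V" using assms by auto
  ultimately show ?thesis
    using card_edges_in_remove[of "insert v V" v] assms by simp
qed

lemma poly_mu_3:
  assumes "distinct [a, b, c]"
  shows "poly (mu {a, b, c}) x = x ^ 3 - (adj_ind a b + adj_ind a c + adj_ind b c) * x"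
proof -
  have 2: "poly (mu {u, v}) x = x\<^sup>2 - adj_ind u v" if "u \<noteq> v" for u v
    using that poly_mu_insert[of "{v}" u x] by (simp add: mu_singleton power2_eq_square)
  have "{b, c} - {b} = {c}" "{b, c} - {c} = {b}" using assms by auto
  then show ?thesis
    using assms poly_mu_insert[of "{b, c}" a x] 2[of b c]
    by (simp add: mu_singleton algebra_simps power2_eq_square power3_eq_cube)
qed

lemma poly_mu_4:
  assumes "distinct [a, b, c, d]"
  shows "poly (mu {a, b, c, d}) x = x ^ 4
    - (adj_ind a b + adj_ind a c + adj_ind a d + adj_ind b c + adj_ind b d + adj_ind c d) * x\<^sup>2
    + (adj_ind a b * adj_ind c d + adj_ind a c * adj_ind b d + adj_ind a d * adj_ind b c)"
proof -
  have 2: "poly (mu {u, v}) x = x\<^sup>2 - adj_ind u v" if "u \<noteq> v" for u v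
    using that poly_mu_insert[of "{v}" u x] by (simp add: mu_singleton power2_eq_square)
  have "{b, c, d} - {b} = {c, d}" "{b, c, d} - {c} = {b, d}" "{b, c, d} - {d} = {b, c}"
    using assms by auto
  then show ?thesis
    using assms poly_mu_insert[of "{b, c, d}" a x] poly_mu_3[of b c d x] 2[of b c] 2[of b d] 2[of c d]
    by (simp add: algebra_simps power2_eq_square power3_eq_cube power4_eq_xxxx)
qed

lemma poly_mu_5:
  assumes "distinct [a, b, c, d, e]"
  shows "poly (mu {a, b, c, d, e}) x = x ^ 5
    - (adj_ind a b + adj_ind a c + adj_ind a d + adj_ind a e + adj_ind b c
       + adj_ind b d + adj_ind b e + adj_ind c d + adj_ind c e + adj_ind d e) * x ^ 3
    + (adj_ind b c * adj_ind d e + adj_ind b d * adj_ind c e + adj_ind b e * adj_ind c d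
       + adj_ind a b * (adj_ind c d + adj_ind c e + adj_ind d e)
       + adj_ind a c * (adj_ind b d + adj_ind b e + adj_ind d e)
       + adj_ind a d * (adj_ind b c + adj_ind b e + adj_ind c e)
       + adj_ind a e * (adj_ind b c + adj_ind b d + adj_ind c d)) * x"
proof -
  have "{b, c, d, e} - {b} = {c, d, e}" "{b, c, d, e} - {c} = {b, d, e}"
    "{b, c, d, e} - {d} = {b, c, e}" "{b, c, d, e} - {e} = {b, c, d}"
    using assms by auto
  then show ?thesis
    using assms poly_mu_insert[of "{b, c, d, e}" a x] poly_mu_4[of b c d e x]
      poly_mu_3[of b c d x] poly_mu_3[of b c e x] poly_mu_3[of b d e x] poly_mu_3[of c d e x]
    by (simp add: algebra_simps power2_eq_square power3_eq_cube power4_eq_xxxx power_numeral_reduce)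
qed

text \<open>At \<open>1\<close> the polynomial is \<open>1 - m + m\<^sub>2\<close>, where \<open>m\<close> is the number of edges and \<open>m\<^sub>2\<close> that of
  2-matchings.  The complete graph has fifteen 2-matchings, and each edge lies in three of them, so the
  \<open>10 - m\<close> missing edges destroy at most \<open>3 * (10 - m)\<close>; hence \<open>m\<^sub>2 \<ge> 3 * m - 15\<close> and \<open>m \<le> 7\<close>.\<close>

lemma card_edges_5_le:
  assumes d: "distinct [a, b, c, d, e]" and root: "poly (mu {a, b, c, d, e}) 1 = 0"
  shows "card (edges_in {a, b, c, d, e}) \<le> 7"
proof -
  (* Summed over the fifteen pairs of disjoint edges, this is the bound 3 * m - 15. *)
  have le: "adj_ind u v + adj_ind u' v' - 1 \<le> adj_ind u v * adj_ind u' v'" for u v u' v'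
    by (simp add: adj_ind_def)
  have "real (card (edges_in {e})) = 0" "real (card (edges_in {d, e})) = adj_ind d e"
    using d card_edges_in_insert[of "{}" e] card_edges_in_insert[of "{e}" d]
    by simp_all
  then have "real (card (edges_in {a, b, c, d, e})) =
    adj_ind a b + adj_ind a c + adj_ind a d + adj_ind a e + adj_ind b c
       + adj_ind b d + adj_ind b e + adj_ind c d + adj_ind c e + adj_ind d e"
    using d card_edges_in_insert[of "{b, c, d, e}" a] card_edges_in_insert[of "{c, d, e}" b]
      card_edges_in_insert[of "{d, e}" c] by simp
  then have "real (card (edges_in {a, b, c, d, e})) \<le> 7"
    using root unfolding poly_mu_5[OF d] power_one mult_1_right distrib_left
    using le[of b c d e] le[of b d c e] le[of b e c d] le[of a b c d] le[of a b c e] le[of a b d e]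
      le[of a c b d] le[of a c b e] le[of a c d e] le[of a d b c] le[of a d b e] le[of a d c e]
      le[of a e b c] le[of a e b d] le[of a e c d]
    by linarith
  then show ?thesis by simp
qed

text \<open>After deletion of a path there must remain at least \<open>2 * k\<close> vertices, the degree of the divisor that
  survives.\<close>

lemma path_length_le:
  assumes V: "finite V" "card V = 2 * k + 5" and dvd: "[:-1, 0, 1:] ^ Suc k dvd mu V"
    and xs: "path xs" "set xs \<subseteq> V"
  shows "length xs \<le> 5"
proof (cases "xs = []")
  case False
  have "[:-1, 0, 1:] ^ k dvd mu (V - set xs)"
    using X2_minus_1_dvd_mu_remove_path[OF V(1) xs False dvd] .
  then have "degree ([:-1, 0, 1:] ^ k :: real poly) \<le> degree (mu (V - set xs))"
    using V(1) by (intro dvd_imp_degree_le mu_nonzero) auto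
  moreover have "degree ([:-1, 0, 1:] ^ k :: real poly) = 2 * k"
    by (simp add: degree_power_eq)
  moreover have "card (set xs) = length xs"
    using xs(1) by (simp add: path_def distinct_card)
  moreover have "card (set xs) \<le> card V" using V(1) xs(2) by (rule card_mono)
  ultimately show ?thesis
    using V xs(2) degree_mu[of "V - set xs"] by (simp add: card_Diff_subset)
qed simp

text \<open>The hub is the middle vertex \<open>c\<close> of the path.  Outside the path the graph consists of \<open>k\<close> disjoint
  edges, and any adjacency that does not fit would extend the path or an edge \<open>{x, y}\<close> outside it to
  a path on six vertices.\<close>

lemma hub_exists_if_P5:
  assumes V: "finite V" "card V = 2 * k + 5" and dvd: "[:-1, 0, 1:] ^ Suc k dvd mu V"
    and edges: "card (edges_in V) \<ge> k + 8"
    and P: "path [a, b, c, d, e]" "{a, b, c, d, e} \<subseteq> V"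
  shows "\<exists>h\<in>V. matched (V - {h})"
proof -
  define R where "R = V - {a, b, c, d, e}"
  have dist: "distinct [a, b, c, d, e]" and adj: "adj a b" "adj b c" "adj c d" "adj d e"
    using P(1) by (auto simp: path_def)
  have finR: "finite R" and cardR: "card R = 2 * k"
    using V dist P(2) by (simp_all add: R_def card_Diff_subset)
  have VR: "V = {a, b, c, d, e} \<union> R" using P(2) by (auto simp: R_def)
  have "[:-1, 0, 1:] ^ k dvd mu R"
    using X2_minus_1_dvd_mu_remove_path[OF V(1) P(1) _ _ dvd] P(2) by (simp add: R_def)
  then have R: "pairwise disjnt (edges_in R)" "card (edges_in R) = k"
    using edges_in_matching_if_dvd[OF finR, of k 0] cardR by auto
  have "\<Union>(edges_in R) = R"
    using finR Union_edges_in_subset card_Union_edges_in[OF finR R(1)] R(2) cardR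
    by (intro card_subset_eq) auto
  then have matched: "matched R" using R by (simp add: matched_def)
  have no6: False if "path [u1, u2, u3, u4, u5, u6]" "{u1, u2, u3, u4, u5, u6} \<subseteq> V" for u1 u2 u3 u4 u5 u6
    using path_length_le[OF V dvd that(1)] that(2) by simp
  have outside: "\<not> adj a x \<and> \<not> adj b x \<and> \<not> adj d x \<and> \<not> adj e x" if x: "x \<in> R" for x
  proof -
    obtain y where y: "y \<in> R" "adj x y"
      using x matched mate_exists[of x R] by (auto simp: matched_def)
    have "x \<noteq> y" using y by auto
    have V': "{a, b, c, d, e, x, y} \<subseteq> V" and ne: "x \<notin> {a, b, c, d, e}" "y \<notin> {a, b, c, d, e}"
      using x y P(2) by (auto simp: R_def)
    have "\<not> path [x, a, b, c, d, e]" "\<not> path [x, e, d, c, b, a]"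
      "\<not> path [y, x, b, c, d, e]" "\<not> path [y, x, d, c, b, a]"
      using no6 V' by blast+
    then show ?thesis
      using dist adj y ne \<open>x \<noteq> y\<close> by (auto simp: path_def adj_sym)
  qed
  show ?thesis
  proof (cases "\<exists>x\<in>R. adj c x")
    case True
    (* The two edges {a, b} and {d, e} of the path are not joined to each other, since y, x, c
       could be continued through both of them. *)
    then obtain x where x: "x \<in> R" "adj c x" by blast
    obtain y where y: "y \<in> R" "adj x y"
      using x matched mate_exists[of x R] by (auto simp: matched_def)
    have "x \<noteq> y" using y by auto
    have V': "{a, b, c, d, e, x, y} \<subseteq> V" and ne: "x \<notin> {a, b, c, d, e}" "y \<notin> {a, b, c, d, e}"
      using x y P(2) by (auto simp: R_def)
    have "\<not> path [y, x, c, b, a, d]" "\<not> path [y, x, c, b, d, e]"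
      "\<not> path [y, x, c, b, a, e]" "\<not> path [y, x, c, d, e, b]"
      using no6 V' by blast+
    then have inside: "\<not> adj a d" "\<not> adj b d" "\<not> adj a e" "\<not> adj b e"
      using dist adj x y ne \<open>x \<noteq> y\<close> by (auto simp: path_def adj_sym)
    have eq: "edges_in (V - {c}) = insert {a, b} (insert {d, e} (edges_in R))"
    proof (intro equalityI subsetI)
      fix f assume "f \<in> edges_in (V - {c})"
      then obtain u v where f: "f = {u, v}" "u \<in> V - {c}" "v \<in> V - {c}" "u \<noteq> v" "adj u v"
        by (rule edges_inE)
      have "u \<in> {a, b, d, e} \<union> R" "v \<in> {a, b, d, e} \<union> R" using f VR by auto
      then show "f \<in> insert {a, b} (insert {d, e} (edges_in R))"
        using f outside inside adj_sym by (auto simp: doubleton_in_edges_in)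
    next
      fix f assume "f \<in> insert {a, b} (insert {d, e} (edges_in R))"
      moreover have "edges_in R \<subseteq> edges_in (V - {c})"
        by (rule edges_in_mono) (auto simp: R_def)
      ultimately show "f \<in> edges_in (V - {c})"
        using adj dist P(2) by (auto simp: doubleton_in_edges_in)
    qed
    have disjR: "disjnt {a, b} f" "disjnt {d, e} f" if "f \<in> edges_in R" for f
      using that by (auto simp: edges_in_def R_def disjnt_def)
    have "matched (V - {c})"
      unfolding matched_def eq
    proof
      show "pairwise disjnt (insert {a, b} (insert {d, e} (edges_in R)))"
        using R(1) dist disjR by (auto simp: pairwise_insert disjnt_sym)
      show "\<Union>(insert {a, b} (insert {d, e} (edges_in R))) = V - {c}"
        using \<open>\<Union>(edges_in R) = R\<close> dist P(2) by (auto simp: R_def)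
    qed
    then show ?thesis using P(2) by blast
  next
    case False
    (* The five vertices form a union of components.  The rest accounts for the multiplicity k,
       so 1 is still a root of the matching polynomial on these five vertices. *)
    then have sep: "\<not> adj x p" if "p \<in> {a, b, c, d, e}" "x \<in> R" for p x
      using that outside adj_sym by blast
    have "mu V = [:-1, 0, 1:] ^ k * mu {a, b, c, d, e}"
      unfolding VR R(2)[symmetric]
      by (rule mu_Un_matched) (use sep finR matched in \<open>auto simp: R_def\<close>)
    then have "[:-1, 0, 1:] dvd mu {a, b, c, d, e}"
      using dvd by (simp add: mult.commute[of _ "[:-1, 0, 1:] ^ k"] del: mult_pCons_left mult_pCons_right)
    then have "poly (mu {a, b, c, d, e}) 1 = 0"
      by (auto elim: dvdE)
    then have le7: "card (edges_in {a, b, c, d, e}) \<le> 7"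
      by (rule card_edges_5_le[OF dist])
    have "edges_in V \<subseteq> edges_in {a, b, c, d, e} \<union> edges_in R"
    proof
      fix f assume "f \<in> edges_in V"
      then obtain u v where f: "f = {u, v}" "u \<in> V" "v \<in> V" "u \<noteq> v" "adj u v"
        by (rule edges_inE)
      then have "u \<in> {a, b, c, d, e} \<and> v \<in> {a, b, c, d, e} \<or> u \<in> R \<and> v \<in> R"
        using sep adj_sym VR by (metis UnE)
      then show "f \<in> edges_in {a, b, c, d, e} \<union> edges_in R"
        using f by (auto simp: doubleton_in_edges_in)
    qed
    then have "card (edges_in V) \<le> card (edges_in {a, b, c, d, e} \<union> edges_in R)"
      using finR by (intro card_mono) (auto simp: finite_edges_in)
    also have "\<dots> \<le> 7 + k"
      using card_Un_le[of "edges_in {a, b, c, d, e}" "edges_in R"] le7 R(2) by simp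
    finally show ?thesis using edges by simp
  qed
qed

lemma doubleton_in_pairs_of_4:
  assumes "u \<in> {a, b, c, d}" "v \<in> {a, b, c, d}" "u \<noteq> v"
  shows "{u, v} \<in> {{a, b}, {a, c}, {a, d}, {b, c}, {b, d}, {c, d}}"
  using assms by (elim insertE emptyE; simp add: doubleton_eq_iff)

text \<open>Outside the path there are \<open>k\<close> disjoint edges and one isolated vertex \<open>w\<close>.  An edge between the path
  and one of those \<open>k\<close> edges, or between \<open>w\<close> and an end of the path, would give a path on five
  vertices, and so would \<open>w\<close> being joined to both \<open>b\<close> and \<open>c\<close>.  There remain six possible edges
  within the path and one at \<open>w\<close>.\<close>

lemma card_edges_le_if_no_P5:
  assumes V: "finite V" "card V = 2 * k + 5" and dvd: "[:-1, 0, 1:] ^ Suc k dvd mu V"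
    and P: "path [a, b, c, d]" "{a, b, c, d} \<subseteq> V"
    and no5: "\<And>u1 u2 u3 u4 u5. path [u1, u2, u3, u4, u5] \<Longrightarrow> {u1, u2, u3, u4, u5} \<subseteq> V \<Longrightarrow> False"
  shows "card (edges_in V) \<le> k + 7"
proof -
  define R where "R = V - {a, b, c, d}"
  have dist: "distinct [a, b, c, d]" and adj: "adj a b" "adj b c" "adj c d"
    using P(1) by (auto simp: path_def)
  have finR: "finite R" and cardR: "card R = 2 * k + 1"
    using V dist P(2) by (simp_all add: R_def card_Diff_subset)
  have VR: "V = {a, b, c, d} \<union> R" using P(2) by (auto simp: R_def)
  have "[:-1, 0, 1:] ^ k dvd mu R"
    using X2_minus_1_dvd_mu_remove_path[OF V(1) P(1) _ _ dvd] P(2) by (simp add: R_def)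
  then have R: "pairwise disjnt (edges_in R)" "card (edges_in R) = k"
    using edges_in_matching_if_dvd[OF finR, of k 1] cardR by auto
  have "card (R - \<Union>(edges_in R)) = 1"
    using finR Union_edges_in_subset[of R] card_Union_edges_in[OF finR R(1)] R(2) cardR
    by (subst card_Diff_subset) (auto intro: finite_subset)
  then obtain w where w: "R - \<Union>(edges_in R) = {w}"
    by (auto simp: card_1_singleton_iff)
  then have wR: "w \<in> R" by blast
  have ad: "\<not> adj a x \<and> \<not> adj d x" if x: "x \<in> R" for x
  proof -
    have "\<not> path [x, a, b, c, d]" "\<not> path [x, d, c, b, a]"
      using no5 x VR by blast+
    moreover have "x \<notin> {a, b, c, d}" using x by (auto simp: R_def)
    ultimately show ?thesis
      using dist adj by (auto simp: path_def adj_sym)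
  qed
  have bc: "\<not> adj b x \<and> \<not> adj c x" if x: "x \<in> R" "x \<noteq> w" for x
  proof -
    obtain y where y: "y \<in> R" "adj x y"
      using x w mate_exists[of x R] by blast
    have "x \<noteq> y" using y by auto
    have "\<not> path [y, x, b, c, d]" "\<not> path [y, x, c, b, a]"
      using no5 x y VR by blast+
    moreover have "x \<notin> {a, b, c, d}" "y \<notin> {a, b, c, d}" using x y by (auto simp: R_def)
    ultimately show ?thesis
      using dist adj y \<open>x \<noteq> y\<close> by (auto simp: path_def adj_sym)
  qed
  have w_one: "\<not> (adj b w \<and> adj c w)"
  proof -
    have "\<not> path [a, b, w, c, d]" using no5 wR VR by blast
    moreover have "w \<notin> {a, b, c, d}" using wR by (auto simp: R_def)
    ultimately show ?thesis
      using dist adj by (auto simp: path_def adj_sym)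
  qed
  (* If w has no neighbour in {b, c}, the pair {z, w} is a harmless surplus in ?F. *)
  define z where "z = (if adj b w then b else c)"
  let ?F = "{{a, b}, {a, c}, {a, d}, {b, c}, {b, d}, {c, d}, {z, w}}"
  have "edges_in V \<subseteq> edges_in R \<union> ?F"
  proof
    fix f assume "f \<in> edges_in V"
    then obtain u v where f: "f = {u, v}" "u \<in> V" "v \<in> V" "u \<noteq> v" "adj u v"
      by (rule edges_inE)
    have out: "x = w \<and> p = z" if "x \<in> R" "p \<in> {a, b, c, d}" "adj p x" for x p
      using that ad bc w_one by (auto simp: z_def)
    consider "u \<in> R" "v \<in> R" | "u \<in> R" "v \<in> {a, b, c, d}" | "u \<in> {a, b, c, d}" "v \<in> R"
      | "u \<in> {a, b, c, d}" "v \<in> {a, b, c, d}"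
      using f VR by blast
    then show "f \<in> edges_in R \<union> ?F"
    proof cases
      case 1
      then show ?thesis using f by (simp add: doubleton_in_edges_in)
    next
      case 2
      then have "u = w \<and> v = z" using out f adj_sym by blast
      then have "f = {z, w}" using f(1) by blast
      then show ?thesis by blast
    next
      case 3
      then have "v = w \<and> u = z" using out f by blast
      then have "f = {z, w}" using f(1) by blast
      then show ?thesis by blast
    next
      case 4
      have "f \<in> {{a, b}, {a, c}, {a, d}, {b, c}, {b, d}, {c, d}}"
        using doubleton_in_pairs_of_4[OF 4 f(4)] by (simp only: f(1))
      moreover have "{{a, b}, {a, c}, {a, d}, {b, c}, {b, d}, {c, d}} \<subseteq> ?F"
        by (intro insert_mono empty_subsetI)
      ultimately show ?thesis by (rule UnI2[OF subsetD, rotated])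
    qed
  qed
  then have "card (edges_in V) \<le> card (edges_in R \<union> ?F)"
    using finR by (intro card_mono) (auto simp: finite_edges_in)
  also have "\<dots> \<le> card (edges_in R) + card ?F" by (rule card_Un_le)
  also have "card ?F \<le> 7"
    using card_length[of "[{a, b}, {a, c}, {a, d}, {b, c}, {b, d}, {c, d}, {z, w}]"]
    by (simp only: list.set list.size)
  finally show ?thesis using R(2) by simp
qed

lemma hub_exists:
  assumes V: "finite V" "card V = 2 * k + 5" and dvd: "[:-1, 0, 1:] ^ Suc k dvd mu V"
    and edges: "card (edges_in V) \<ge> k + 8" "card (edges_in V) > 2 * k + 5"
  shows "\<exists>h\<in>V. matched (V - {h})"
proof -
  have "\<exists>a b c d. path [a, b, c, d] \<and> {a, b, c, d} \<subseteq> V"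
  proof (rule ccontr)
    assume no: "\<nexists>a b c d. path [a, b, c, d] \<and> {a, b, c, d} \<subseteq> V"
    have "card (edges_in V) \<le> card V"
      by (rule card_edges_le_if_no_P4[OF V(1)]) (use no in fast)
    then show False using edges(2) V(2) by simp
  qed
  then obtain a b c d where P4: "path [a, b, c, d]" "{a, b, c, d} \<subseteq> V" by fast
  have "\<exists>a b c d e. path [a, b, c, d, e] \<and> {a, b, c, d, e} \<subseteq> V"
  proof (rule ccontr)
    assume no: "\<nexists>a b c d e. path [a, b, c, d, e] \<and> {a, b, c, d, e} \<subseteq> V"
    have "card (edges_in V) \<le> k + 7"
      by (rule card_edges_le_if_no_P5[OF V dvd P4]) (use no in fast)
    then show False using edges(1) by simp
  qed
  then obtain a b c d e where "path [a, b, c, d, e]" "{a, b, c, d, e} \<subseteq> V" by fast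
  then show ?thesis by (rule hub_exists_if_P5[OF V dvd edges(1)])
qed

end

section \<open>Isomorphism with S(r,s)\<close>

lemma graph_iso_if_image:
  assumes G: "simple_graph G" and f: "bij_betw f (verts G) (verts H)"
    and E: "(`) f ` edges G = edges H"
  shows "graph_iso G H"
proof -
  have "{u, v} \<in> edges G" if uv: "u \<in> verts G" "v \<in> verts G" "{f u, f v} \<in> edges H" for u v
  proof -
    obtain e where e: "e \<in> edges G" "f ` e = f ` {u, v}"
      using uv(3) unfolding E[symmetric] by auto
    then have "e \<subseteq> verts G" using G by (auto simp: simple_graph_def)
    then have "e = {u, v}"
      using e(2) uv inj_on_image_eq_iff[OF bij_betw_imp_inj_on[OF f], of e "{u, v}"] by simp
    then show ?thesis using e(1) by simp
  qed
  moreover have "{f u, f v} \<in> edges H" if "{u, v} \<in> edges G" for u v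
    using that unfolding E[symmetric] by (intro image_eqI[of _ _ "{u, v}"]) auto
  ultimately show ?thesis
    unfolding graph_iso_def using f by blast
qed

lemma edge_set_if_simple_graph: "simple_graph G \<Longrightarrow> edge_set (edges G)"
  by unfold_locales (auto simp: simple_graph_def)

lemma edges_in_verts: "simple_graph G \<Longrightarrow> edge_set.edges_in (edges G) (verts G) = edges G"
  by (auto simp: edge_set.edges_in_def edge_set_if_simple_graph simple_graph_def)

lemma mu_verts:
  assumes "simple_graph G"
  shows "edge_set.mu (edges G) (verts G) = map_poly real_of_int (matching_poly G)"
  by (simp add: edge_set.mu_def edge_set_if_simple_graph edges_in_verts assms)

lemma matching_poly_eq_iff_mu_eq:
  assumes "simple_graph G" "simple_graph H"
  shows "matching_poly G = matching_poly H \<longleftrightarrow>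
    edge_set.mu (edges G) (verts G) = edge_set.mu (edges H) (verts H)"
proof -
  have "p = q" if "map_poly real_of_int p = map_poly real_of_int q" for p q
  proof (rule poly_eqI)
    fix n
    show "coeff p n = coeff q n"
      using arg_cong[OF that, of "\<lambda>p. coeff p n"] by (simp add: coeff_map_poly)
  qed
  then show ?thesis unfolding mu_verts[OF assms(1)] mu_verts[OF assms(2)] by metis
qed

context
  fixes r s :: nat
  assumes r: "0 < r" and s: "2 * r - 1 \<le> s" "s \<le> 2 * r"
begin

interpretation S: edge_set "edges (S_graph r s)"
  using s simple_graph_S_graph by (intro edge_set_if_simple_graph) simp

lemma S_graph_edges_off_hub:
  "S.edges_in ({0..2 * r} - {0}) = (\<lambda>i. {2 * i + 1, 2 * i + 2}) ` {..<r}"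
  unfolding S.edges_in_def using s by (auto simp: S_graph_def)

lemma S_graph_matched: "S.matched ({0..2 * r} - {0})"
  unfolding S.matched_def S_graph_edges_off_hub
proof
  show "pairwise disjnt ((\<lambda>i. {2 * i + 1, 2 * i + 2}) ` {..<r})"
    by (auto simp: pairwise_def disjnt_def) presburger+
  show "(\<Union>i<r. {2 * i + 1, 2 * i + 2}) = {0..2 * r} - {0}"
  proof (intro equalityI subsetI)
    fix x assume x: "x \<in> {0..2 * r} - {0}"
    then have "(x - 1) div 2 < r" "x = 2 * ((x - 1) div 2) + 1 \<or> x = 2 * ((x - 1) div 2) + 2"
      by (simp_all, presburger+)
    then show "x \<in> (\<Union>i<r. {2 * i + 1, 2 * i + 2})" by blast
  qed auto
qed

lemma S_graph_card_edges_off_hub: "card (S.edges_in ({0..2 * r} - {0})) = r"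
proof -
  have "inj_on (\<lambda>i::nat. {2 * i + 1, 2 * i + 2}) {..<r}"
    by (auto simp: inj_on_def doubleton_eq_iff)
  then show ?thesis unfolding S_graph_edges_off_hub by (simp add: card_image)
qed

lemma S_graph_card_hub_nbrs: "card {w \<in> {0..2 * r}. S.adj 0 w} = s"
proof -
  have "{w \<in> {0..2 * r}. S.adj 0 w} = (\<lambda>i. 2 * i + 1) ` {..<r} \<union> (\<lambda>i. 2 * i + 2) ` {..<s - r}"
    unfolding S.adj_def using s by (auto simp: S_graph_def doubleton_eq_iff)
  moreover have "(\<lambda>i. 2 * i + 1) ` {..<r} \<inter> (\<lambda>i. 2 * i + 2) ` {..<s - r} = {}"
    by auto presburger
  ultimately show ?thesis
    using s r by (simp add: card_Un_disjoint card_image inj_on_def)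
qed

lemma S_graph_card_edges: "card (edges (S_graph r s)) = r + s"
  using S.card_edges_in_remove[of "{0..2 * r}" 0] S_graph_card_edges_off_hub S_graph_card_hub_nbrs
    edges_in_verts[OF simple_graph_S_graph[OF s(2)]]
  by (simp add: S_graph_def)

lemma mu_S_graph:
  "edge_set.mu (edges (S_graph r s)) (verts (S_graph r s)) =
    [:0, 1:] * [:-1, 0, 1:] ^ (r - 1) * ([:-1, 0, 1:] - [:of_nat s:])"
  using S.mu_hub[of "{0..2 * r}" 0 "r - 1"] S_graph_matched S_graph_card_edges_off_hub
    S_graph_card_hub_nbrs r
  by (simp add: S_graph_def)

end

text \<open>At most one vertex is not adjacent to the hub, so the disjoint edges can be enumerated with the edge
  containing that vertex at the end and with an end \<open>a i\<close> adjacent to the hub named first.  This defines a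
  bijection that maps edges to edges, and it is onto because both graphs have \<open>r + s\<close> edges.\<close>

lemma (in edge_set) graph_iso_S_graph_if_hub:
  assumes r: "0 < r" and s: "2 * r - 1 \<le> s" "s \<le> 2 * r"
    and V: "finite V" "h \<in> V" "matched (V - {h})"
    and card: "card V = 2 * r + 1" "card {w \<in> V. adj h w} = s"
  shows "graph_iso (S_graph r s) (V, edges_in V)"
proof -
  let ?M = "edges_in (V - {h})"
  define Z where "Z = {w \<in> V - {h}. \<not> adj h w}"
  have disj: "pairwise disjnt ?M" and UM: "\<Union>?M = V - {h}"
    using V(3) by (auto simp: matched_def)
  have finM: "finite ?M" using V(1) by (simp add: finite_edges_in)
  have cardM: "card ?M = r"
    using card_Union_edges_in[OF _ disj] V card unfolding UM by simp
  have finZ: "finite Z" using V(1) by (simp add: Z_def)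
  have "V - {h} = {w \<in> V. adj h w} \<union> Z" by (auto simp: Z_def)
  moreover have "card ({w \<in> V. adj h w} \<union> Z) = card {w \<in> V. adj h w} + card Z"
    using V(1) finZ by (intro card_Un_disjoint) (auto simp: Z_def)
  ultimately have "card (V - {h}) = card {w \<in> V. adj h w} + card Z" by simp
  then have cardZ: "card Z = 2 * r - s" using V card by simp
  obtain e0 where e0: "e0 \<in> ?M" "Z \<subseteq> e0"
  proof (cases "Z = {}")
    case True
    have "?M \<noteq> {}" using cardM r by auto
    then show ?thesis using True that by blast
  next
    case False
    then have "card Z \<noteq> 0" using finZ by simp
    then have "card Z = 1" using cardZ s by linarith
    then obtain z where z: "Z = {z}" by (auto simp: card_1_singleton_iff)
    then have "z \<in> \<Union>?M" unfolding UM by (auto simp: Z_def)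
    then show ?thesis using z that by blast
  qed
  have "card (?M - {e0}) = r - 1" using cardM e0(1) finM by simp
  moreover have "\<exists>g0. bij_betw g0 {0..<card (?M - {e0})} (?M - {e0})"
    by (rule ex_bij_betw_nat_finite) (simp add: finM)
  ultimately have "\<exists>g0. bij_betw g0 {..<r - 1} (?M - {e0})"
    by (simp only: atLeast0LessThan)
  then obtain g0 where g0: "bij_betw g0 {..<r - 1} (?M - {e0})" ..
  define g where "g i = (if i < r - 1 then g0 i else e0)" for i
  have g_last: "i = r - 1" if "i < r" "g i = e0" for i
  proof (rule ccontr)
    assume "i \<noteq> r - 1"
    then have i: "i < r - 1" using that(1) by simp
    then have "g0 i \<in> ?M - {e0}" using bij_betw_apply[OF g0] by blast
    then show False using that(2) i by (simp add: g_def)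
  qed
  have g_img: "g ` {..<r} = ?M"
  proof -
    have "{..<r} = insert (r - 1) {..<r - 1}" using r by auto
    moreover have "g ` {..<r - 1} = g0 ` {..<r - 1}" by (auto simp: g_def)
    moreover have "g (r - 1) = e0" by (simp add: g_def)
    ultimately have "g ` {..<r} = insert e0 (?M - {e0})"
      using bij_betw_imp_surj_on[OF g0] by (simp only: image_insert)
    then show ?thesis by (simp only: insert_Diff[OF e0(1)])
  qed
  have "\<exists>a b. g i = {a, b} \<and> adj h a \<and> (i < s - r \<longrightarrow> adj h b)" if i: "i < r" for i
  proof -
    have giM: "g i \<in> ?M" using g_img i by blast
    then obtain a b where ab: "g i = {a, b}" "a \<in> V - {h}" "b \<in> V - {h}" "a \<noteq> b" "adj a b"
      by (rule edges_inE)
    show ?thesis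
    proof (cases "g i \<inter> Z = {}")
      case True
      then show ?thesis using ab by (auto simp: Z_def)
    next
      case False
      then have "g i = e0"
        using disj giM e0 by (auto simp: pairwise_def disjnt_def)
      then have "i = r - 1" using g_last[OF i] by blast
      moreover have "s \<noteq> 2 * r" using False cardZ finZ by auto
      ultimately have "\<not> i < s - r" using s by simp
      moreover have "adj h a \<or> adj h b"
      proof (rule ccontr)
        assume "\<not> (adj h a \<or> adj h b)"
        then have "{a, b} \<subseteq> Z" using ab by (auto simp: Z_def)
        then have "card {a, b} \<le> card Z" using finZ by (intro card_mono)
        then show False using cardZ s ab(4) by simp
      qed
      ultimately show ?thesis using ab(1) by (metis insert_commute)
    qed
  qed
  then obtain a b where ab: "\<And>i. i < r \<Longrightarrow> g i = {a i, b i}" "\<And>i. i < r \<Longrightarrow> adj h (a i)"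
    "\<And>i. i < s - r \<Longrightarrow> i < r \<Longrightarrow> adj h (b i)"
    by metis
  define f where "f n = (if n = 0 then h else if odd n then a (n div 2) else b (n div 2 - 1))" for n
  have f: "f 0 = h" "f (2 * i + 1) = a i" "f (2 * i + 2) = b i" for i
    by (simp_all add: f_def)
  have abV: "a i \<in> V" "b i \<in> V" if "i < r" for i
  proof -
    have "g i \<in> ?M" using g_img that by blast
    then show "a i \<in> V" "b i \<in> V" using ab(1)[OF that] by (auto simp: edges_in_def)
  qed
  have img: "f ` {0..2 * r} = V"
  proof
    show "f ` {0..2 * r} \<subseteq> V"
    proof
      fix y assume "y \<in> f ` {0..2 * r}"
      then obtain n where n: "n \<le> 2 * r" "y = f n" by auto
      show "y \<in> V"
      proof (cases "n = 0")
        case False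
        have "(n - 1) div 2 < r" "n = 2 * ((n - 1) div 2) + 1 \<or> n = 2 * ((n - 1) div 2) + 2"
          using n(1) False by presburger+
        then show ?thesis using n(2) f(2,3) abV by metis
      qed (use n f V in auto)
    qed
    show "V \<subseteq> f ` {0..2 * r}"
    proof
      fix y assume y: "y \<in> V"
      show "y \<in> f ` {0..2 * r}"
      proof (cases "y = h")
        case True
        then show ?thesis using f(1) by force
      next
        case False
        then have "y \<in> \<Union>(g ` {..<r})" using y unfolding g_img UM by simp
        then obtain i where i: "i < r" "y = a i \<or> y = b i" using ab(1) by auto
        then have "y = f (2 * i + 1) \<or> y = f (2 * i + 2)" unfolding f by simp
        moreover have "2 * i + 1 \<in> {0..2 * r}" "2 * i + 2 \<in> {0..2 * r}" using i by auto
        ultimately show ?thesis by blast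
      qed
    qed
  qed
  then have bij: "bij_betw f {0..2 * r} V"
    unfolding bij_betw_def using card(1) by (auto intro: eq_card_imp_inj_on)
  have sub: "(`) f ` edges (S_graph r s) \<subseteq> edges_in V"
  proof
    fix e assume "e \<in> (`) f ` edges (S_graph r s)"
    then obtain e' where e': "e' \<in> edges (S_graph r s)" "e = f ` e'" by blast
    then consider i where "i < r" "e' = {2 * i + 1, 2 * i + 2}" | i where "i < r" "e' = {0, 2 * i + 1}"
      | i where "i < s - r" "e' = {0, 2 * i + 2}"
      by (auto simp: S_graph_def)
    then show "e \<in> edges_in V"
    proof cases
      case (1 i)
      then have "e = g i" using e' f ab(1) by simp
      then show ?thesis using g_img 1 edges_in_mono[of "V - {h}" V] by blast
    next
      case (2 i)
      then have "e = {h, a i}" using e' f by simp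
      then show ?thesis using 2 ab(2) abV V by (simp add: doubleton_in_edges_in)
    next
      case (3 i)
      then have "i < r" using s by simp
      moreover have "e = {h, b i}" using e' f 3 by simp
      ultimately show ?thesis using 3 ab(3) abV V by (simp add: doubleton_in_edges_in)
    qed
  qed
  have S: "simple_graph (S_graph r s)" using s by (intro simple_graph_S_graph)
  have "verts (S_graph r s) = {0..2 * r}" by (simp add: S_graph_def)
  then have "edges (S_graph r s) \<subseteq> Pow {0..2 * r}"
    using S unfolding simple_graph_def by blast
  then have "inj_on ((`) f) (edges (S_graph r s))"
    using inj_on_subset[OF inj_on_image_Pow] bij_betw_imp_inj_on[OF bij] by blast
  then have "card ((`) f ` edges (S_graph r s)) = r + s"
    using S_graph_card_edges[OF r s] by (simp add: card_image)
  also have "\<dots> = card (edges_in V)"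
    using card_edges_in_remove[OF V(1,2)] card(2) cardM by simp
  finally have "(`) f ` edges (S_graph r s) = edges_in V"
    using sub V(1) by (intro card_subset_eq) (auto simp: finite_edges_in)
  then show ?thesis
    using bij by (intro graph_iso_if_image[OF S, of f]) (auto simp: S_graph_def)
qed

text \<open>Order and number of edges are read off the first coefficients of the matching polynomial; the
  divisibility by a power of \<open>X\<^sup>2 - 1\<close> then provides a hub.\<close>

lemma matching_unique_S_graph:
  assumes r: "0 < r" and s: "2 * r - 1 \<le> s" "s \<le> 2 * r" and large: "r = 1 \<or> 6 \<le> s"
  shows "matching_unique (S_graph r s)"
  unfolding matching_unique_def comatching_def
proof (rule notI, elim exE conjE)
  fix H :: "nat ugraph"
  assume H: "simple_graph H" and niso: "\<not> graph_iso (S_graph r s) H"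
    and eq: "matching_poly (S_graph r s) = matching_poly H"
  let ?V = "verts H"
  have S: "simple_graph (S_graph r s)" using s by (intro simple_graph_S_graph)
  interpret S: edge_set "edges (S_graph r s)" using S by (rule edge_set_if_simple_graph)
  interpret H: edge_set "edges H" using H by (rule edge_set_if_simple_graph)
  have finV: "finite ?V" and finS: "finite (verts (S_graph r s))"
    using H S by (simp_all add: simple_graph_def)
  have mu: "H.mu ?V = S.mu (verts (S_graph r s))"
    using eq matching_poly_eq_iff_mu_eq[OF S H] by simp
  then have cardV: "card ?V = 2 * r + 1"
    using H.degree_mu[OF finV] S.degree_mu[OF finS] by (simp add: S_graph_def)
  have cS: "card (verts (S_graph r s)) = 2 * r + 1" by (simp add: S_graph_def)
  have E: "H.edges_in ?V = edges H" using edges_in_verts[OF H] .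
  have cardE: "card (edges H) = r + s"
    using H.coeff_mu[of 1 ?V] S.coeff_mu[of 1 "verts (S_graph r s)"] mu cardV cS r
      H.num_matchings_induced_1[of ?V] S.num_matchings_induced_1[of "verts (S_graph r s)"]
      S_graph_card_edges[OF r s] edges_in_verts[OF S] E by simp
  have "\<exists>h\<in>?V. H.matched (?V - {h})"
  proof (cases "r = 1")
    case True
    then have "edges H \<noteq> {}" using cardE by auto
    then obtain e where e: "e \<in> edges H" by blast
    then have "card e = 2" "e \<subseteq> ?V" using H by (auto simp: simple_graph_def)
    then have "card (?V - e) = 1"
      using finV cardV True by (simp add: card_Diff_subset finite_subset)
    then obtain h where h: "?V - e = {h}" by (auto simp: card_1_singleton_iff)
    then have Ve: "?V - {h} = e" using \<open>e \<subseteq> ?V\<close> by blast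
    have "f = e" if "f \<in> edges H" "f \<subseteq> e" for f
      using that \<open>card e = 2\<close> H by (intro card_subset_eq) (auto simp: simple_graph_def intro: card_ge_0_finite)
    then have "H.edges_in e = {e}" using e by (auto simp: H.edges_in_def)
    then have "H.matched e" by (simp add: H.matched_def)
    then show ?thesis using Ve h by blast
  next
    case False
    then have "6 \<le> s" "3 \<le> r" using large s by auto
    have "[:-1, 0, 1:] ^ (r - 1) dvd H.mu ?V"
      unfolding mu mu_S_graph[OF r s] by (intro dvd_mult2 dvd_mult dvd_refl)
    moreover have "r - 1 = Suc (r - 2)" using \<open>3 \<le> r\<close> by simp
    ultimately have "[:-1, 0, 1:] ^ Suc (r - 2) dvd H.mu ?V" by (simp only:)
    then show ?thesis
      using \<open>6 \<le> s\<close> \<open>3 \<le> r\<close> s cardV cardE E finV by (intro H.hub_exists[of _ "r - 2"]) auto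
  qed
  then obtain h where h: "h \<in> ?V" "H.matched (?V - {h})" by blast
  then have disj: "pairwise disjnt (H.edges_in (?V - {h}))" "\<Union>(H.edges_in (?V - {h})) = ?V - {h}"
    by (auto simp: H.matched_def)
  have "card (H.edges_in (?V - {h})) = r"
    using H.card_Union_edges_in[OF _ disj(1)] finV cardV h(1) unfolding disj(2) by simp
  then have "card {w \<in> ?V. H.adj h w} = s"
    using H.card_edges_in_remove[OF finV h(1)] cardE E by simp
  then have "graph_iso (S_graph r s) (?V, H.edges_in ?V)"
    using H.graph_iso_S_graph_if_hub[OF r s finV h cardV] by simp
  then show False using niso E by simp
qed

section \<open>The exceptional graphs\<close>

lemma not_matching_unique_if_mu_eq:
  fixes H :: "nat ugraph"
  assumes r: "0 < r" and s: "2 * r - 1 \<le> s" "s \<le> 2 * r" and H: "simple_graph H"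
    and niso: "\<not> graph_iso (S_graph r s) H"
    and mu: "\<And>x. poly (edge_set.mu (edges H) (verts H)) x = x * (x\<^sup>2 - 1) ^ (r - 1) * (x\<^sup>2 - 1 - real s)"
  shows "\<not> matching_unique (S_graph r s)"
proof -
  have S: "simple_graph (S_graph r s)" using s by (intro simple_graph_S_graph)
  have "edge_set.mu (edges (S_graph r s)) (verts (S_graph r s)) = edge_set.mu (edges H) (verts H)"
    by (intro poly_eq_poly_eq_iff[THEN iffD1] ext)
      (simp add: mu mu_S_graph[OF r s] of_nat_poly algebra_simps power2_eq_square)
  then have "matching_poly (S_graph r s) = matching_poly H"
    using matching_poly_eq_iff_mu_eq[OF S H] by simp
  then show ?thesis
    using H niso unfolding matching_unique_def comatching_def by blast
qed

lemma graph_iso_S_graphD: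
  assumes "graph_iso (S_graph r s) H"
  shows "\<exists>f. bij_betw f {0..2 * r} (verts H) \<and> (\<forall>u\<le>2 * r. \<forall>v\<le>2 * r.
    {u, v} \<in> edges (S_graph r s) \<longrightarrow> {f u, f v} \<in> edges H)"
proof -
  have "verts (S_graph r s) = {0..2 * r}" by (simp add: S_graph_def)
  then show ?thesis
    using assms unfolding graph_iso_def by (metis atLeastAtMost_iff le0)
qed

text \<open>An isomorphism invariant of \<open>S(r,s)\<close>: some vertex is adjacent to all others but at most one.\<close>

lemma hub_if_graph_iso_S_graph:
  assumes iso: "graph_iso (S_graph r s) H" and s: "2 * r - 1 \<le> s"
  shows "\<exists>h\<in>verts H. \<exists>z. \<forall>y\<in>verts H. y \<noteq> h \<longrightarrow> y \<noteq> z \<or> s = 2 * r \<longrightarrow> {h, y} \<in> edges H"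
proof -
  obtain f where f: "bij_betw f {0..2 * r} (verts H)"
    "\<forall>u\<le>2 * r. \<forall>v\<le>2 * r. {u, v} \<in> edges (S_graph r s) \<longrightarrow> {f u, f v} \<in> edges H"
    using graph_iso_S_graphD[OF iso] by blast
  show ?thesis
  proof (intro bexI exI ballI impI)
    show "f 0 \<in> verts H" using f(1) by (rule bij_betw_apply) simp
    fix y assume y: "y \<in> verts H" "y \<noteq> f 0" "y \<noteq> f (2 * r) \<or> s = 2 * r"
    then have "y \<in> f ` {0..2 * r}" using bij_betw_imp_surj_on[OF f(1)] by simp
    then obtain v where v: "y = f v" "v \<le> 2 * r" by auto
    then have v': "v \<noteq> 0" "v \<noteq> 2 * r \<or> s = 2 * r" using y(2,3) by metis+
    have "(\<exists>i<r. v = 2 * i + 1) \<or> (\<exists>i<s - r. v = 2 * i + 2)"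
    proof (cases "odd v")
      case True
      then obtain i where "v = 2 * i + 1" by (rule oddE)
      then show ?thesis using v(2) by auto
    next
      case False
      then obtain j where j: "v = 2 * j" by blast
      then have "j - 1 < s - r" "v = 2 * (j - 1) + 2" using v(2) v' s by auto
      then show ?thesis by blast
    qed
    then have "{0, v} \<in> edges (S_graph r s)" by (auto simp: S_graph_def)
    then show "{f 0, y} \<in> edges H" using f(2) v by blast
  qed
qed

text \<open>The comatching graph is bipartite, whereas \<open>S(2,3)\<close> contains a triangle.\<close>

lemma not_matching_unique_S_2_3: "\<not> matching_unique (S_graph 2 3)"
proof (rule not_matching_unique_if_mu_eq)
  let ?H = "({0, 1, 2, 3, 4}, {{0, 1}, {1, 2}, {2, 3}, {3, 0}, {0, 4}}) :: nat ugraph"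
  show H: "simple_graph ?H" by (simp add: simple_graph_def)
  interpret edge_set "edges ?H" using H by (rule edge_set_if_simple_graph)
  show "\<not> graph_iso (S_graph 2 3) ?H"
  proof
    assume "graph_iso (S_graph 2 3) ?H"
    from graph_iso_S_graphD[OF this] obtain f where f: "\<And>u v. u \<le> 2 * 2 \<Longrightarrow> v \<le> 2 * 2 \<Longrightarrow>
        {u, v} \<in> edges (S_graph 2 3) \<Longrightarrow> {f u, f v} \<in> edges ?H"
      by blast
    have "{0, 1} \<in> edges (S_graph 2 3)" "{0, 2} \<in> edges (S_graph 2 3)" "{1, 2} \<in> edges (S_graph 2 3)"
      by (auto simp: S_graph_def doubleton_eq_iff)
    moreover have le: "(0::nat) \<le> 2 * 2" "(1::nat) \<le> 2 * 2" "(2::nat) \<le> 2 * 2" by simp_all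
    ultimately have "{f 0, f 1} \<in> edges ?H" "{f 0, f 2} \<in> edges ?H" "{f 1, f 2} \<in> edges ?H"
      using f[OF le(1,2)] f[OF le(1,3)] f[OF le(2,3)] by blast+
    moreover have bipartite: "x \<in> {0, 2} \<longleftrightarrow> y \<notin> {0, 2}" if "{x, y} \<in> edges ?H" for x y
      using that by (auto simp: doubleton_eq_iff)
    ultimately show False by blast
  qed
  have dist: "distinct [0, 1, 2, 3, 4 :: nat]" by simp
  show "poly (mu (verts ?H)) x = x * (x\<^sup>2 - 1) ^ (2 - 1) * (x\<^sup>2 - 1 - real 3)" for x
    unfolding fst_conv poly_mu_5[of 0 1 2 3 4, OF dist]
    unfolding adj_ind_def adj_def
    by (simp add: doubleton_eq_iff algebra_simps power2_eq_square power_numeral_reduce)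
qed simp_all

text \<open>The degrees in the comatching graph are 3, 3, 3, 2, 1, so it has no vertex adjacent to all others.\<close>

lemma not_matching_unique_S_2_4: "\<not> matching_unique (S_graph 2 4)"
proof (rule not_matching_unique_if_mu_eq)
  let ?H = "({0, 1, 2, 3, 4}, {{0, 1}, {0, 2}, {1, 2}, {1, 3}, {2, 3}, {0, 4}}) :: nat ugraph"
  show H: "simple_graph ?H" by (simp add: simple_graph_def)
  interpret edge_set "edges ?H" using H by (rule edge_set_if_simple_graph)
  show "\<not> graph_iso (S_graph 2 4) ?H"
  proof
    assume "graph_iso (S_graph 2 4) ?H"
    from hub_if_graph_iso_S_graph[OF this] obtain h where h: "h \<in> {0, 1, 2, 3, 4}"
      and adj: "\<And>y. y \<in> {0, 1, 2, 3, 4} \<Longrightarrow> y \<noteq> h \<Longrightarrow> {h, y} \<in> edges ?H"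
      unfolding fst_conv by fastforce
    show False
      using h adj[of 0] adj[of 3] adj[of 4] by (auto simp: doubleton_eq_iff)
  qed
  have dist: "distinct [0, 1, 2, 3, 4 :: nat]" by simp
  show "poly (mu (verts ?H)) x = x * (x\<^sup>2 - 1) ^ (2 - 1) * (x\<^sup>2 - 1 - real 4)" for x
    unfolding fst_conv poly_mu_5[of 0 1 2 3 4, OF dist]
    unfolding adj_ind_def adj_def
    by (simp add: doubleton_eq_iff algebra_simps power2_eq_square power_numeral_reduce)
qed simp_all

text \<open>The comatching graph is disconnected: every vertex misses at least the vertices of the other
  component, so two of them.\<close>

lemma not_matching_unique_S_3_5: "\<not> matching_unique (S_graph 3 5)"
proof (rule not_matching_unique_if_mu_eq)
  let ?H = "({0, 1, 2, 3, 4, 5, 6},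
    {{0, 1}, {0, 2}, {0, 3}, {0, 4}, {1, 2}, {1, 3}, {1, 4}, {5, 6}}) :: nat ugraph"
  show H: "simple_graph ?H" by (simp add: simple_graph_def)
  interpret edge_set "edges ?H" using H by (rule edge_set_if_simple_graph)
  show "\<not> graph_iso (S_graph 3 5) ?H"
  proof
    assume iso: "graph_iso (S_graph 3 5) ?H"
    have "2 * 3 - 1 \<le> (5::nat)" by simp
    from hub_if_graph_iso_S_graph[OF iso this] obtain h z where h: "h \<in> verts ?H"
      and adj: "\<And>y. y \<in> verts ?H \<Longrightarrow> y \<noteq> h \<Longrightarrow> y \<noteq> z \<Longrightarrow> {h, y} \<in> edges ?H"
      by blast
    have two: False if "y \<in> verts ?H - {h}" "y' \<in> verts ?H - {h}" "y \<noteq> y'"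
      "{h, y} \<notin> edges ?H" "{h, y'} \<notin> edges ?H" for y y'
      using that adj by blast
    consider "h \<in> {0, 1, 2, 3, 4}" | "h \<in> {5, 6}" using h by auto
    then show False
    proof cases
      case 1
      show False by (rule two[of 5 6]) (use 1 in \<open>auto simp: doubleton_eq_iff\<close>)
    next
      case 2
      show False by (rule two[of 0 1]) (use 2 in \<open>auto simp: doubleton_eq_iff\<close>)
    qed
  qed
  have dist: "distinct [0, 1, 2, 3, 4 :: nat]" by simp
  have "mu (verts ?H) = [:-1, 0, 1:] * mu (verts ?H - {5, 6})"
  proof (rule mu_isolated_edge)
    show "adj 5 6" unfolding adj_def by simp
    show "w = 6" if "adj 5 w" for w using that unfolding adj_def by (simp add: doubleton_eq_iff)
    show "w = 5" if "adj 6 w" for w using that unfolding adj_def by (simp add: doubleton_eq_iff)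
  qed simp_all
  moreover have "verts ?H - {5, 6} = {0, 1, 2, 3, 4}" by auto
  ultimately have eq: "mu (verts ?H) = [:-1, 0, 1:] * mu {0, 1, 2, 3, 4}" by (simp only:)
  have "poly (mu (verts ?H)) x = (x\<^sup>2 - 1) * poly (mu {0, 1, 2, 3, 4}) x" for x
    unfolding eq poly_mult by (simp add: power2_eq_square)
  note this[unfolded poly_mu_5[of 0 1 2 3 4, OF dist], unfolded adj_ind_def adj_def]
  then show "poly (mu (verts ?H)) x = x * (x\<^sup>2 - 1) ^ (3 - 1) * (x\<^sup>2 - 1 - real 5)" for x
    by (simp add: doubleton_eq_iff algebra_simps power2_eq_square power_numeral_reduce)
qed simp_all

theorem theorem14:
  "(\<forall>s::nat. s > 0 \<longrightarrow>
      (s \<notin> {3, 4, 5} \<longrightarrow> matching_unique (S_graph (nat \<lceil>real s / 2\<rceil>) s)) \<and>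
      (s \<in> {3, 4, 5} \<longrightarrow> \<not> matching_unique (S_graph (nat \<lceil>real s / 2\<rceil>) s))) \<and>
   (\<forall>n::nat. n > 0 \<and> n \<noteq> 2 \<longrightarrow> matching_unique (friendship_graph n))"
proof (intro conjI allI impI)
  have ceil: "nat \<lceil>real s / 2\<rceil> = (s + 1) div 2" for s
    by linarith
  fix s :: nat assume "s > 0"
  show "matching_unique (S_graph (nat \<lceil>real s / 2\<rceil>) s)" if "s \<notin> {3, 4, 5}"
    unfolding ceil
  proof (intro matching_unique_S_graph)
    have "s = 1 \<or> s = 2 \<or> 6 \<le> s" using \<open>s > 0\<close> that by auto
    then show "(s + 1) div 2 = 1 \<or> 6 \<le> s" by auto
  qed (use \<open>s > 0\<close> in presburger)+
  show "\<not> matching_unique (S_graph (nat \<lceil>real s / 2\<rceil>) s)" if "s \<in> {3, 4, 5}"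
    unfolding ceil using that not_matching_unique_S_2_3 not_matching_unique_S_2_4 not_matching_unique_S_3_5
    by auto
next
  fix n :: nat assume "n > 0 \<and> n \<noteq> 2"
  then show "matching_unique (friendship_graph n)"
    unfolding friendship_graph_eq_S_graph by (intro matching_unique_S_graph) auto
qed


end
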